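(* Let $r\in(0,1)$ and $A_r=\{z\in\mathbb{C}: r<|z|<1\}$. For $d=k$ or $d=c$ and for any $z\in A_r$, $$m^d_{A_r}(z)<1,$$ and for any $p\in\partial A_r$, $$\lim_{z\to p}m^d_{A_r}(z)=1.$$
   Context: $\mathbb{D}$ is the open unit disk in $\mathbb{C}$, and $\rho_{\mathbb{D}}$ is the Poincaré distance on $\mathbb{D}$ with density $\frac{2}{1-|z|^2}$. For a bounded domain $X\subset\mathbb{C}$: - The Carathéodory distance is $c_X(z_1,z_2)=\sup\{\rho_{\mathbb{D}}(f(z_1),f(z_2)) : f:X\to\mathbb{D}\text{ holomorphic}\}$. - The Kobayashi distance is $k_X(z_1,z_2)=\inf \sum_{i=1}^m\rho_{\mathbb{D}}(a_i,b_i)$, the infimum over all $m\ge1$, $a_i,b_i\in\mathbb{D}$ and holomorphic $f_i:\mathbb{D}\to X$ with $f_1(a_1)=z_1$, $f_i(b_i)=f_{i+1}(a_{i+1})$ for $1\le i<m$, and $f_m(b_m)=z_2$. For $d=k$ or $c$, $B^d_X(z;s)=\{w\in X: d_X(z,w)<s\}$, and the Fridman function is $$H^d_X(z)=\sup\{\tanh\tfrac s2 : s>0,\ B^d_X(z;s)\subset f(\mathbb{D})\text{ for some injective holomorphic } f:\mathbb{D}\to X\}.$$ The squeezing function is $$S_X(z)=\sup\{\tanh\tfrac s2 : s>0,\ B^k_{\mathbb{D}}(f(z);s)\subset f(X)\text{ for some injective holomorphic } f:X\to\mathbb{D}\}.$$ The quotient invariant is $m^d_X(z)=\dfrac{S_X(z)}{H^d_X(z)}$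 for $z\in X$. *)

theory Defs
  imports "HOL-Complex_Analysis.Complex_Analysis"
begin

abbreviation unit_disk :: "complex set" where
  "unit_disk \<equiv> ball 0 1"

text \<open>
  Infimum of the lengths of the piecewise C1 paths in the disk from \<open>a\<close> to \<open>b\<close>, with
  respect to the density \<open>2 / (1 - |z|^2)\<close>. A \<^const>\<open>valid_path\<close> may have an unbounded
  derivative near its finitely many exceptional points and hence infinite length, in which case
  \<^const>\<open>integral\<close> would return \<open>0\<close>; using \<^const>\<open>has_integral\<close> restricts the
  infimum to the paths of finite length.
\<close>
definition poincare_dist :: "complex \<Rightarrow> complex \<Rightarrow> real" where
  "poincare_dist a b = Inf {L. \<exists>\<gamma>. valid_path \<gamma> \<and> path_image \<gamma> \<subseteq> unit_disk \<and>
     pathstart \<gamma> = a \<and> pathfinish \<gamma> = b \<and>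
     ((\<lambda>t. 2 / (1 - (norm (\<gamma> t))\<^sup>2) * norm (vector_derivative \<gamma> (at t)))
        has_integral L) {0..1}}"

text \<open>
  The notions below are meant for bounded domains \<open>X\<close> and points of \<open>X\<close>; there all
  the suprema and infima range over nonempty bounded sets of reals.
\<close>
definition caratheodory_dist :: "complex set \<Rightarrow> complex \<Rightarrow> complex \<Rightarrow> real" where
  "caratheodory_dist X z1 z2 = Sup {poincare_dist (f z1) (f z2) | f.
     f holomorphic_on X \<and> f ` X \<subseteq> unit_disk}"

definition kobayashi_dist :: "complex set \<Rightarrow> complex \<Rightarrow> complex \<Rightarrow> real" where
  "kobayashi_dist X z1 z2 = Inf {\<Sum>i=1..m. poincare_dist (a i) (b i) |
     (m::nat) (a :: nat \<Rightarrow> complex) (b :: nat \<Rightarrow> complex) (f :: nat \<Rightarrow> complex \<Rightarrow> complex).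
     1 \<le> m \<and>
     (\<forall>i\<in>{1..m}. a i \<in> unit_disk \<and> b i \<in> unit_disk \<and>
        f i holomorphic_on unit_disk \<and> f i ` unit_disk \<subseteq> X) \<and>
     f 1 (a 1) = z1 \<and>
     (\<forall>i\<in>{1..<m}. f i (b i) = f (i + 1) (a (i + 1))) \<and>
     f m (b m) = z2}"

text \<open>
  The argument \<open>d\<close> assigns to every domain a distance, e.g. \<^const>\<open>kobayashi_dist\<close>
  or \<^const>\<open>caratheodory_dist\<close>.
\<close>
definition dist_ball ::
  "(complex set \<Rightarrow> complex \<Rightarrow> complex \<Rightarrow> real) \<Rightarrow> complex set \<Rightarrow> complex \<Rightarrow> real \<Rightarrow> complex set" where
  "dist_ball d X z s = {w \<in> X. d X z w < s}"

definition fridman ::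
  "(complex set \<Rightarrow> complex \<Rightarrow> complex \<Rightarrow> real) \<Rightarrow> complex set \<Rightarrow> complex \<Rightarrow> real" where
  "fridman d X z = Sup {tanh (s / 2) | s. s > 0 \<and>
     (\<exists>f. f holomorphic_on unit_disk \<and> inj_on f unit_disk \<and> f ` unit_disk \<subseteq> X \<and>
          dist_ball d X z s \<subseteq> f ` unit_disk)}"

definition squeezing :: "complex set \<Rightarrow> complex \<Rightarrow> real" where
  "squeezing X z = Sup {tanh (s / 2) | s. s > 0 \<and>
     (\<exists>f. f holomorphic_on X \<and> inj_on f X \<and> f ` X \<subseteq> unit_disk \<and>
          dist_ball kobayashi_dist unit_disk (f z) s \<subseteq> f ` X)}"

definition quotient_invariant ::
  "(complex set \<Rightarrow> complex \<Rightarrow> complex \<Rightarrow> real) \<Rightarrow> complex set \<Rightarrow> complex \<Rightarrow> real" where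
  "quotient_invariant d X z = squeezing X z / fridman d X z"

definition annulus :: "real \<Rightarrow> complex set" where
  "annulus r = {z. r < norm z \<and> norm z < 1}"

end

theory Submission imports Defs begin

text \<open>
  Let \<open>f\<close> be an injective holomorphic map of the annulus into the disk with
  \<open>f z = 0\<close> whose image contains the disk of radius \<open>t\<close>. The inverse of
  \<open>f\<close> on that disk shows that the Fridman function is at least \<open>t\<close>, because
  \<open>|f w| \<ge> t\<close> forces \<open>w\<close> to be at Caratheodory distance at least
  \<open>2 artanh t\<close> from \<open>z\<close>. To gain a definite amount, note that by injectivity
  \<open>|f|\<close> is bounded away from \<open>1\<close> near one of the two boundary circles, say the
  inner one (the other case follows from the inversion \<open>\<zeta> \<mapsto> r / \<zeta>\<close>).
  Then \<open>f\<close> can be multiplied by a suitable zero-free factor that makes it larger at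
  \<open>w\<close>, so a competitor beats \<open>f\<close> there. All constants depend only on
  \<open>r\<close> and \<open>z\<close>: the lemma of Schwarz and Pick, applied along the universal
  covering of the annulus, bounds \<open>|f|\<close> on circles uniformly in \<open>f\<close>.
  So no extremal map is needed.

  At the boundary, the inclusion and the inversion, as competitors for the squeezing function,
  show that it tends to \<open>1\<close>, whereas the Fridman function is at most \<open>1\<close>.
\<close>

section \<open>The Poincare distance\<close>

lemma one_minus_cnj_mult_nonzero:
  fixes a z :: complex
  assumes "norm a < 1" "norm z < 1"
  shows "1 - cnj a * z \<noteq> 0"
proof
  assume "1 - cnj a * z = 0"
  then have "norm (cnj a * z) = 1" by (metis eq_iff_diff_eq_0 norm_one)
  moreover have "norm (cnj a * z) < 1"
    using assms norm_mult_less[of "cnj a" 1 z 1] by simp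
  ultimately show False by simp
qed

lemma one_minus_norm_Moebius_sq:
  assumes "norm a < 1" "norm z < 1"
  shows "1 - (norm (Moebius_function 0 a z))\<^sup>2
    = (1 - (norm a)\<^sup>2) * (1 - (norm z)\<^sup>2) / (norm (1 - cnj a * z))\<^sup>2"
proof -
  have "(norm (1 - cnj a * z))\<^sup>2 - (norm (z - a))\<^sup>2 = (1 - (norm a)\<^sup>2) * (1 - (norm z)\<^sup>2)"
    unfolding cmod_power2 by (simp add: power2_eq_square algebra_simps)
  moreover have "norm (1 - cnj a * z) \<noteq> 0"
    using one_minus_cnj_mult_nonzero[OF assms] by simp
  ultimately show ?thesis
    by (simp add: Moebius_function_simple norm_divide power_divide field_simps)
qed

lemma Moebius_function_has_field_derivative:
  assumes "norm a < 1" "norm z < 1"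
  shows "(Moebius_function 0 a has_field_derivative
    of_real (1 - (norm a)\<^sup>2) / (1 - cnj a * z)\<^sup>2) (at z)"
proof -
  have nz: "1 - cnj a * z \<noteq> 0" by (rule one_minus_cnj_mult_nonzero[OF assms])
  have "((\<lambda>z. (z - a) / (1 - cnj a * z)) has_field_derivative
     ((1 - cnj a * z) - (z - a) * (- cnj a)) / (1 - cnj a * z)\<^sup>2) (at z)"
    using nz by (auto intro!: derivative_eq_intros simp: power2_eq_square)
  moreover have "(1 - cnj a * z) - (z - a) * (- cnj a) = of_real (1 - (norm a)\<^sup>2)"
    using complex_norm_square[of a] by (simp add: algebra_simps)
  ultimately show ?thesis
    unfolding Moebius_function_simple[abs_def] by (simp only:)
qed

text \<open>Infinitesimal form of the invariance of the density \<open>2 / (1 - |z|^2)\<close> under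
  Moebius maps; it reduces length computations to curves through 0.\<close>

lemma Moebius_density:
  assumes "norm a < 1" "norm z < 1"
  shows "norm (of_real (1 - (norm a)\<^sup>2) / (1 - cnj a * z)\<^sup>2 :: complex)
    = (1 - (norm (Moebius_function 0 a z))\<^sup>2) / (1 - (norm z)\<^sup>2)"
proof -
  have "(norm a)\<^sup>2 < 1" "(norm z)\<^sup>2 < 1" using assms by (simp_all add: power_less_one_iff)
  then show ?thesis
    by (simp only: one_minus_norm_Moebius_sq[OF assms] norm_divide norm_of_real norm_power) simp
qed

lemma tanh_artanh_real:
  fixes x :: real
  assumes "\<bar>x\<bar> < 1"
  shows "tanh (artanh x) = x"
proof -
  have "exp (- 2 * artanh x) = (1 - x) / (1 + x)"
    using assms by (simp add: artanh_def exp_minus field_simps)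
  then show ?thesis
    using assms by (simp only: tanh_real_altdef) (simp add: field_simps)
qed

lemma artanh_less_iff_real:
  fixes x y :: real
  assumes "\<bar>x\<bar> < 1" "\<bar>y\<bar> < 1"
  shows "artanh x < artanh y \<longleftrightarrow> x < y"
  using tanh_artanh_real assms tanh_real_less_iff by metis

lemma artanh_le_iff_real:
  fixes x y :: real
  assumes "\<bar>x\<bar> < 1" "\<bar>y\<bar> < 1"
  shows "artanh x \<le> artanh y \<longleftrightarrow> x \<le> y"
  using artanh_less_iff_real assms by (meson not_le)

lemma norm_Moebius_commute:
  "norm (Moebius_function 0 a b) = norm (Moebius_function 0 b a)"
proof -
  have "norm (1 - cnj a * b) = norm (1 - cnj b * a)"
    using complex_mod_cnj[of "1 - cnj a * b"] by (simp add: mult.commute)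
  then show ?thesis
    by (simp add: Moebius_function_simple norm_divide norm_minus_commute)
qed

section \<open>Calibration and the explicit Poincare distance\<close>

text \<open>
  \<open>Re G\<close> calibrates the geodesic from \<open>a\<close> to \<open>b\<close>: its increments bound the
  length of every path from below.
\<close>
lemma poincare_calibration:
  assumes a: "a \<in> unit_disk" and b: "b \<in> unit_disk"
  obtains G G' where
    "\<And>z. z \<in> unit_disk \<Longrightarrow> (G has_field_derivative G' z) (at z)"
    "\<And>z. z \<in> unit_disk \<Longrightarrow> norm (G' z) \<le> 2 / (1 - (norm z)\<^sup>2)"
    "Re (G b) - Re (G a) = 2 * artanh (norm (Moebius_function 0 a b))"
proof -
  define \<delta> where "\<delta> = norm (Moebius_function 0 a b)"
  \<comment> \<open>A rotation that turns the value at \<open>b\<close> into the nonnegative real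
    \<delta>; the default 1 covers \<open>a = b\<close>, where there is no direction to
    correct.\<close>
  define c where "c = (if \<delta> = 0 then 1 else of_real \<delta> / Moebius_function 0 a b)"
  have c: "norm c = 1" "c * Moebius_function 0 a b = of_real \<delta>"
    by (auto simp: c_def \<delta>_def norm_divide)
  define \<phi> where "\<phi> = (\<lambda>z. c * Moebius_function 0 a z)"
  define \<phi>' where "\<phi>' = (\<lambda>z. c * (of_real (1 - (norm a)\<^sup>2) / (1 - cnj a * z)\<^sup>2))"
  have \<phi>_norm: "norm (\<phi> z) = norm (Moebius_function 0 a z)" for z
    by (simp add: \<phi>_def norm_mult c)
  have \<phi>_less: "norm (\<phi> z) < 1" if "z \<in> unit_disk" for z
    unfolding \<phi>_norm using Moebius_function_norm_lt_1 a that by auto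
  have D: "(\<phi> has_field_derivative \<phi>' z) (at z)" if "z \<in> unit_disk" for z
    unfolding \<phi>_def \<phi>'_def using a that
    by (intro DERIV_cmult Moebius_function_has_field_derivative) auto
  \<comment> \<open>This is \<open>2 * artanh (\<phi> z)\<close>, a primitive of
    \<open>2 * \<phi>' / (1 - \<phi>^2)\<close>; both logarithms are holomorphic because
    \<open>1 + \<phi>\<close> and \<open>1 - \<phi>\<close> have positive real part.\<close>
  define G where "G = (\<lambda>z. Ln (1 + \<phi> z) - Ln (1 - \<phi> z))"
  define G' where "G' = (\<lambda>z. \<phi>' z / (1 + \<phi> z) + \<phi>' z / (1 - \<phi> z))"
  have Repos: "0 < Re (1 + \<phi> z)" "0 < Re (1 - \<phi> z)" if "z \<in> unit_disk" for z
    using \<phi>_less[OF that] abs_Re_le_cmod[of "\<phi> z"] by auto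
  have nz: "1 + \<phi> z \<noteq> 0" "1 - \<phi> z \<noteq> 0" if "z \<in> unit_disk" for z
    using Repos[OF that] by (metis less_irrefl zero_complex.sel(1))+
  show thesis
  proof
    fix z assume z: "z \<in> unit_disk"
    have *: "1 + \<phi> z \<notin> \<real>\<^sub>\<le>\<^sub>0" "1 - \<phi> z \<notin> \<real>\<^sub>\<le>\<^sub>0"
      using Repos[OF z] by (auto simp: complex_nonpos_Reals_iff)
    show "(G has_field_derivative G' z) (at z)"
      unfolding G_def G'_def using * nz[OF z]
      by (auto intro!: derivative_eq_intros D[OF z] simp: divide_simps)
    \<comment> \<open>\<open>|1 - \<phi>^2|\<close> is at least \<open>P = 1 - |\<phi>|^2\<close>,
      and \<open>|\<phi>'| = P / Q\<close> by invariance of the density, so \<open>P\<close>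
      cancels.\<close>
    define P Q where "P = 1 - (norm (\<phi> z))\<^sup>2" and "Q = 1 - (norm z)\<^sup>2"
    have PQ: "P > 0" "Q > 0"
      using \<phi>_less[OF z] z by (simp_all add: P_def Q_def power_less_one_iff)
    have 1: "norm (\<phi>' z) = P / Q"
      using Moebius_density[of a z] a z
      by (simp only: \<phi>'_def norm_mult c \<phi>_norm P_def Q_def) simp
    have 2: "P \<le> norm (1 - (\<phi> z)\<^sup>2)"
      using norm_triangle_ineq2[of 1 "(\<phi> z)\<^sup>2"] by (simp add: norm_power P_def)
    have "G' z = 2 * \<phi>' z / (1 - (\<phi> z)\<^sup>2)"
      using nz[OF z] by (simp add: G'_def field_simps power2_eq_square)
    then have "norm (G' z) = 2 * (P / Q) / norm (1 - (\<phi> z)\<^sup>2)"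
      by (simp add: norm_divide norm_mult 1)
    also have "\<dots> \<le> 2 * (P / Q) / P"
      using PQ 2 by (intro divide_left_mono mult_pos_pos) auto
    also have "\<dots> = 2 / (1 - (norm z)\<^sup>2)"
      using PQ by (simp add: Q_def)
    finally show "norm (G' z) \<le> 2 / (1 - (norm z)\<^sup>2)" .
  next
    have d: "0 \<le> \<delta>" "\<delta> < 1"
      using Moebius_function_norm_lt_1[of a b] a b by (auto simp: \<delta>_def)
    have "\<phi> a = 0" by (simp add: \<phi>_def Moebius_function_eq_zero)
    moreover have "\<phi> b = of_real \<delta>" by (simp add: \<phi>_def c)
    moreover have "1 + of_real \<delta> = (of_real (1 + \<delta>) :: complex)"
      "1 - of_real \<delta> = (of_real (1 - \<delta>) :: complex)"
      by simp_all
    ultimately have "Re (G b) - Re (G a) = ln (1 + \<delta>) - ln (1 - \<delta>)"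
      using d by (simp add: G_def Ln_of_real del: of_real_add of_real_diff)
    then show "Re (G b) - Re (G a) = 2 * artanh (norm (Moebius_function 0 a b))"
      using d by (simp add: artanh_def ln_div flip: \<delta>_def)
  qed
qed

text \<open>The increment of \<open>G\<close> is the contour integral of \<open>G'\<close>, and the
  real part of its integrand is pointwise at most the length integrand.\<close>

lemma calibration_le_length:
  assumes G: "\<And>z. z \<in> unit_disk \<Longrightarrow> (G has_field_derivative G' z) (at z)"
    and G': "\<And>z. z \<in> unit_disk \<Longrightarrow> norm (G' z) \<le> 2 / (1 - (norm z)\<^sup>2)"
    and \<gamma>: "valid_path \<gamma>" "path_image \<gamma> \<subseteq> unit_disk"
    and L: "((\<lambda>t. 2 / (1 - (norm (\<gamma> t))\<^sup>2) * norm (vector_derivative \<gamma> (at t)))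
        has_integral L) {0..1}"
  shows "Re (G (pathfinish \<gamma>)) - Re (G (pathstart \<gamma>)) \<le> L"
proof -
  have "(G' has_contour_integral (G (pathfinish \<gamma>) - G (pathstart \<gamma>))) \<gamma>"
    by (rule contour_integral_primitive[OF _ \<gamma>]) (use G has_field_derivative_at_within in blast)
  then have "((\<lambda>t. Re (G' (\<gamma> t) * vector_derivative \<gamma> (at t)))
      has_integral Re (G (pathfinish \<gamma>) - G (pathstart \<gamma>))) {0..1}"
    unfolding has_contour_integral by (rule has_integral_Re)
  then have "Re (G (pathfinish \<gamma>) - G (pathstart \<gamma>)) \<le> L"
  proof (rule has_integral_le[OF _ L])
    fix t :: real assume "t \<in> {0..1}"
    then have "\<gamma> t \<in> unit_disk" using \<gamma> unfolding path_image_def by blast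
    then have "norm (G' (\<gamma> t)) * norm (vector_derivative \<gamma> (at t))
        \<le> 2 / (1 - (norm (\<gamma> t))\<^sup>2) * norm (vector_derivative \<gamma> (at t))"
      by (intro mult_right_mono G') auto
    then show "Re (G' (\<gamma> t) * vector_derivative \<gamma> (at t))
        \<le> 2 / (1 - (norm (\<gamma> t))\<^sup>2) * norm (vector_derivative \<gamma> (at t))"
      using complex_Re_le_cmod[of "G' (\<gamma> t) * vector_derivative \<gamma> (at t)"]
      by (simp add: norm_mult)
  qed
  then show ?thesis by simp
qed

text \<open>Transport of a radius: the Moebius map taking 0 to \<open>a\<close> maps the segment
  from 0 to \<open>w\<close> to a path from \<open>a\<close> to \<open>b\<close>. By invariance of
  the density its length is that of the segment, with primitive
  \<open>2 * artanh (t * \<delta>)\<close>.\<close>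

lemma exists_path_of_poincare_length:
  assumes a: "a \<in> unit_disk" and b: "b \<in> unit_disk"
  shows "\<exists>\<gamma>. valid_path \<gamma> \<and> path_image \<gamma> \<subseteq> unit_disk \<and>
     pathstart \<gamma> = a \<and> pathfinish \<gamma> = b \<and>
     ((\<lambda>t. 2 / (1 - (norm (\<gamma> t))\<^sup>2) * norm (vector_derivative \<gamma> (at t)))
        has_integral (2 * artanh (norm (Moebius_function 0 a b)))) {0..1}"
proof -
  define w where "w = Moebius_function 0 a b"
  define \<delta> where "\<delta> = norm w"
  have d: "0 \<le> \<delta>" "\<delta> < 1"
    using Moebius_function_norm_lt_1[of a b] a b by (auto simp: \<delta>_def w_def)
  define K where "K = Moebius_function 0 (- a)"
  define \<gamma> where "\<gamma> = K \<circ> linepath 0 w"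
  have na: "norm (- a) < 1" using a by simp
  have holK: "K holomorphic_on unit_disk"
    unfolding K_def by (rule Moebius_function_holomorphic[OF na])
  have img: "path_image (linepath 0 w) \<subseteq> unit_disk"
    using d by (simp add: closed_segment_subset \<delta>_def)
  have inside: "norm (linepath 0 w t) = t * \<delta>" "norm (linepath 0 w t) < 1" if "t \<in> {0..1}" for t
  proof -
    show "norm (linepath 0 w t) = t * \<delta>"
      using that by (simp add: linepath_def \<delta>_def)
    then show "norm (linepath 0 w t) < 1"
      using that d by (auto intro: le_less_trans[OF mult_left_le_one_le])
  qed
  have "valid_path \<gamma>"
    unfolding \<gamma>_def by (rule valid_path_compose_holomorphic[OF _ holK _ img]) auto
  moreover have "path_image \<gamma> \<subseteq> unit_disk"
    using inside Moebius_function_norm_lt_1[OF na]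
    by (auto simp: \<gamma>_def path_image_compose K_def path_image_def)
  moreover have "pathstart \<gamma> = a"
    by (simp add: \<gamma>_def pathstart_compose K_def Moebius_function_of_zero)
  moreover have "pathfinish \<gamma> = b"
    using Moebius_function_compose[of "- a" a b] a b
    by (simp add: \<gamma>_def pathfinish_compose K_def w_def)
  moreover have "((\<lambda>t. 2 / (1 - (norm (\<gamma> t))\<^sup>2) * norm (vector_derivative \<gamma> (at t)))
        has_integral (2 * artanh \<delta>)) {0..1}"
  proof -
    have "((\<lambda>t. 2 * \<delta> / (1 - (t * \<delta>)\<^sup>2)) has_integral
        (2 * artanh (1 * \<delta>) - 2 * artanh (0 * \<delta>))) {0..1}"
    proof (rule fundamental_theorem_of_calculus)
      fix t :: real assume t: "t \<in> {0..1}"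
      have "\<bar>t * \<delta>\<bar> < 1" using inside[OF t] d t by simp
      then have "((\<lambda>t. 2 * artanh (t * \<delta>)) has_real_derivative 2 * \<delta> / (1 - (t * \<delta>)\<^sup>2))
          (at t within {0..1})"
        by (auto intro!: derivative_eq_intros
          DERIV_chain'[of "\<lambda>t. t * \<delta>" \<delta> _ _ artanh, OF _ artanh_real_has_field_derivative])
      then show "((\<lambda>t. 2 * artanh (t * \<delta>)) has_vector_derivative 2 * \<delta> / (1 - (t * \<delta>)\<^sup>2))
          (at t within {0..1})"
        by (simp add: has_real_derivative_iff_has_vector_derivative)
    qed simp
    then have "((\<lambda>t. 2 * \<delta> / (1 - (t * \<delta>)\<^sup>2)) has_integral (2 * artanh \<delta>)) {0..1}"
      by simp
    then show ?thesis
    proof (rule has_integral_eq[rotated])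
      fix t :: real assume t: "t \<in> {0..1}"
      let ?z = "linepath 0 w t"
      have "((K \<circ> linepath 0 w) has_vector_derivative
          w * (of_real (1 - (norm (- a))\<^sup>2) / (1 - cnj (- a) * ?z)\<^sup>2)) (at t)"
        using has_vector_derivative_linepath_within[of 0 w t UNIV]
          Moebius_function_has_field_derivative[OF na inside(2)[OF t]]
        unfolding K_def diff_zero by (rule field_vector_diff_chain_at)
      then have "norm (vector_derivative \<gamma> (at t))
          = \<delta> * norm (of_real (1 - (norm (- a))\<^sup>2) / (1 - cnj (- a) * ?z)\<^sup>2 :: complex)"
        by (simp only: \<gamma>_def vector_derivative_at norm_mult \<delta>_def)
      also have "\<dots> = \<delta> * ((1 - (norm (\<gamma> t))\<^sup>2) / (1 - (t * \<delta>)\<^sup>2))"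
        by (simp only: Moebius_density[OF na inside(2)[OF t]] inside(1)[OF t]) (simp add: \<gamma>_def K_def)
      finally have eq: "norm (vector_derivative \<gamma> (at t)) = \<dots>" .
      have "norm (\<gamma> t) < 1"
        using Moebius_function_norm_lt_1[OF na inside(2)[OF t]] by (simp add: \<gamma>_def K_def)
      then have "1 - (norm (\<gamma> t))\<^sup>2 \<noteq> 0"
        by (smt (verit) norm_ge_zero power_less_one_iff zero_less_numeral)
      then show "2 * \<delta> / (1 - (t * \<delta>)\<^sup>2)
          = 2 / (1 - (norm (\<gamma> t))\<^sup>2) * norm (vector_derivative \<gamma> (at t))"
        unfolding eq by simp
    qed
  qed
  ultimately show ?thesis unfolding \<delta>_def w_def by blast
qed

text \<open>The transported radius attains the infimum, and the calibration bounds every other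
  length from below.\<close>

lemma poincare_dist_eq:
  assumes a: "a \<in> unit_disk" and b: "b \<in> unit_disk"
  shows "poincare_dist a b = 2 * artanh (norm (Moebius_function 0 a b))"
proof -
  obtain G G' where G: "\<And>z. z \<in> unit_disk \<Longrightarrow> (G has_field_derivative G' z) (at z)"
    "\<And>z. z \<in> unit_disk \<Longrightarrow> norm (G' z) \<le> 2 / (1 - (norm z)\<^sup>2)"
    "Re (G b) - Re (G a) = 2 * artanh (norm (Moebius_function 0 a b))"
    using poincare_calibration[OF assms] by metis
  show ?thesis
    unfolding poincare_dist_def
  proof (rule cInf_eq_minimum, goal_cases)
    case 1
    then show ?case using exists_path_of_poincare_length[OF assms] by simp
  next
    case (2 L)
    then obtain \<gamma> where \<gamma>: "valid_path \<gamma>" "path_image \<gamma> \<subseteq> unit_disk"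
      "pathstart \<gamma> = a" "pathfinish \<gamma> = b"
      "((\<lambda>t. 2 / (1 - (norm (\<gamma> t))\<^sup>2) * norm (vector_derivative \<gamma> (at t)))
        has_integral L) {0..1}"
      by blast
    show ?case using calibration_le_length[OF G(1,2) \<gamma>(1,2,5)] G(3) \<gamma>(3,4) by simp
  qed
qed

text \<open>One calibration for the two end points serves the whole chain: the increments of
  \<open>Re G\<close> telescope, and each is at most the distance of consecutive points because a
  path attains that distance.\<close>

lemma poincare_dist_triangle_sum:
  fixes x :: "nat \<Rightarrow> complex"
  assumes "\<And>i. i \<le> n \<Longrightarrow> x i \<in> unit_disk"
  shows "poincare_dist (x 0) (x n) \<le> (\<Sum>i<n. poincare_dist (x i) (x (Suc i)))"
proof -
  obtain G G' where G: "\<And>z. z \<in> unit_disk \<Longrightarrow> (G has_field_derivative G' z) (at z)"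
    "\<And>z. z \<in> unit_disk \<Longrightarrow> norm (G' z) \<le> 2 / (1 - (norm z)\<^sup>2)"
    "Re (G (x n)) - Re (G (x 0)) = 2 * artanh (norm (Moebius_function 0 (x 0) (x n)))"
    using poincare_calibration[of "x 0" "x n"] assms by (metis le_refl zero_le)
  have le: "Re (G q) - Re (G p) \<le> poincare_dist p q" if pq: "p \<in> unit_disk" "q \<in> unit_disk" for p q
  proof -
    obtain \<gamma> where \<gamma>: "valid_path \<gamma>" "path_image \<gamma> \<subseteq> unit_disk" "pathstart \<gamma> = p" "pathfinish \<gamma> = q"
     "((\<lambda>t. 2 / (1 - (norm (\<gamma> t))\<^sup>2) * norm (vector_derivative \<gamma> (at t)))
        has_integral poincare_dist p q) {0..1}"
      using exists_path_of_poincare_length[OF pq] unfolding poincare_dist_eq[OF pq] by blast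
    show ?thesis using calibration_le_length[OF G(1,2) \<gamma>(1,2,5)] \<gamma>(3,4) by simp
  qed
  have "poincare_dist (x 0) (x n) = Re (G (x n)) - Re (G (x 0))"
    using G(3) assms by (simp add: poincare_dist_eq)
  also have "\<dots> = (\<Sum>i<n. Re (G (x (Suc i))) - Re (G (x i)))"
    by (rule sum_lessThan_telescope[of "\<lambda>i. Re (G (x i))" n, symmetric])
  also have "\<dots> \<le> (\<Sum>i<n. poincare_dist (x i) (x (Suc i)))"
    by (intro sum_mono le assms) auto
  finally show ?thesis .
qed

lemma poincare_dist_triangle:
  assumes "a \<in> unit_disk" "b \<in> unit_disk" "c \<in> unit_disk"
  shows "poincare_dist a c \<le> poincare_dist a b + poincare_dist b c"
  using poincare_dist_triangle_sum[of 2 "\<lambda>i. if i = 0 then a else if i = 1 then b else c"] assms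
  by (simp add: numeral_2_eq_2)

lemma poincare_dist_commute:
  assumes "a \<in> unit_disk" "b \<in> unit_disk"
  shows "poincare_dist a b = poincare_dist b a"
  using assms by (simp add: poincare_dist_eq norm_Moebius_commute[of a b])

lemma poincare_dist_0:
  assumes "b \<in> unit_disk"
  shows "poincare_dist 0 b = 2 * artanh (norm b)"
  using assms by (simp add: poincare_dist_eq Moebius_function_simple)

section \<open>The Schwarz-Pick lemma\<close>

text \<open>Moebius maps move \<open>a\<close> and \<open>f a\<close> to 0, which leaves the Schwarz
  lemma for \<open>F\<close>.\<close>

lemma norm_Schwarz_Pick:
  assumes f: "f holomorphic_on unit_disk" "f ` unit_disk \<subseteq> unit_disk"
    and a: "a \<in> unit_disk" and b: "b \<in> unit_disk"
  shows "norm (Moebius_function 0 (f a) (f b)) \<le> norm (Moebius_function 0 a b)"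
proof -
  define F where "F = Moebius_function 0 (f a) \<circ> f \<circ> Moebius_function 0 (- a)"
  have "f a \<in> unit_disk" using a f by blast
  then have na: "norm (- a) < 1" and fa: "norm (f a) < 1" using a by auto
  have M: "norm (Moebius_function 0 (- a) z) < 1" if "norm z < 1" for z
    by (rule Moebius_function_norm_lt_1[OF na that])
  have "F holomorphic_on ball 0 1"
    unfolding F_def o_assoc[symmetric]
    by (intro holomorphic_on_compose_gen[of _ _ _ unit_disk] Moebius_function_holomorphic na fa f)
      (use M f in auto)
  moreover have "F 0 = 0"
    by (simp add: F_def Moebius_function_of_zero Moebius_function_eq_zero)
  moreover have "norm (F z) < 1" if "norm z < 1" for z
    unfolding F_def o_def using f(2) M[OF that] by (intro Moebius_function_norm_lt_1 fa) force
  moreover have "norm (Moebius_function 0 a b) < 1"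
    using a b by (simp add: Moebius_function_norm_lt_1)
  ultimately have "norm (F (Moebius_function 0 a b)) \<le> norm (Moebius_function 0 a b)"
    by (rule Schwarz_Lemma(1))
  moreover have "Moebius_function 0 (- a) (Moebius_function 0 a b) = b"
    using Moebius_function_compose[of "- a" a b] a b by simp
  ultimately show ?thesis by (simp add: F_def)
qed

lemma poincare_dist_Schwarz_Pick:
  assumes f: "f holomorphic_on unit_disk" "f ` unit_disk \<subseteq> unit_disk"
    and a: "a \<in> unit_disk" and b: "b \<in> unit_disk"
  shows "poincare_dist (f a) (f b) \<le> poincare_dist a b"
proof -
  have "f a \<in> unit_disk" "f b \<in> unit_disk" using f a b by blast+
  then show ?thesis
    using norm_Schwarz_Pick[OF assms] a b
    by (simp add: poincare_dist_eq artanh_le_iff_real Moebius_function_norm_lt_1)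
qed

section \<open>Kobayashi and Caratheodory distances\<close>

lemma poincare_dist_nonneg:
  assumes "a \<in> unit_disk" "b \<in> unit_disk"
  shows "0 \<le> poincare_dist a b"
proof -
  have "artanh 0 \<le> artanh (norm (Moebius_function 0 a b))"
    using Moebius_function_norm_lt_1[of a b] assms by (subst artanh_le_iff_real) auto
  then show ?thesis using assms by (simp add: poincare_dist_eq)
qed

text \<open>A chain with a single disk; nonnegative summands keep the infimum bounded below.\<close>

lemma kobayashi_dist_le:
  assumes f: "f holomorphic_on unit_disk" "f ` unit_disk \<subseteq> X"
    and a: "a \<in> unit_disk" and b: "b \<in> unit_disk"
  shows "kobayashi_dist X (f a) (f b) \<le> poincare_dist a b"
  unfolding kobayashi_dist_def
proof (rule cInf_lower)
  show "bdd_below {\<Sum>i=1..m. poincare_dist (a' i) (b' i) |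
     (m::nat) (a' :: nat \<Rightarrow> complex) (b' :: nat \<Rightarrow> complex) (g :: nat \<Rightarrow> complex \<Rightarrow> complex).
     1 \<le> m \<and>
     (\<forall>i\<in>{1..m}. a' i \<in> unit_disk \<and> b' i \<in> unit_disk \<and>
        g i holomorphic_on unit_disk \<and> g i ` unit_disk \<subseteq> X) \<and>
     g 1 (a' 1) = f a \<and>
     (\<forall>i\<in>{1..<m}. g i (b' i) = g (i + 1) (a' (i + 1))) \<and>
     g m (b' m) = f b}"
    by (rule bdd_belowI[of _ 0]) (auto intro!: sum_nonneg poincare_dist_nonneg)
qed (intro CollectI exI[of _ 1] exI[of _ "\<lambda>_. a"] exI[of _ "\<lambda>_. b"] exI[of _ "\<lambda>_. f"],
     use assms in auto)

text \<open>Schwarz-Pick for \<open>g \<circ> f i\<close> bounds each link, and the triangle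
  inequality adds the links up.\<close>

lemma poincare_dist_le_chain:
  fixes a b :: "nat \<Rightarrow> complex" and f :: "nat \<Rightarrow> complex \<Rightarrow> complex"
  assumes g: "g holomorphic_on X" "g ` X \<subseteq> unit_disk"
    and m: "1 \<le> m"
    and f: "\<forall>i\<in>{1..m}. a i \<in> unit_disk \<and> b i \<in> unit_disk \<and>
        f i holomorphic_on unit_disk \<and> f i ` unit_disk \<subseteq> X"
    and z: "f 1 (a 1) = z1" "f m (b m) = z2"
    and link: "\<forall>i\<in>{1..<m}. f i (b i) = f (i + 1) (a (i + 1))"
  shows "poincare_dist (g z1) (g z2) \<le> (\<Sum>i=1..m. poincare_dist (a i) (b i))"
proof -
  \<comment> \<open>Index 0 is the start of the chain and index \<open>i\<close> the end of link
    \<open>i\<close>; by the linking condition, \<open>x i\<close> is also the image of the start of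
    link \<open>i + 1\<close>.\<close>
  define x where "x = (\<lambda>i. if i = 0 then g z1 else g (f i (b i)))"
  have inX: "f i (a i) \<in> X" "f i (b i) \<in> X" if "i \<in> {1..m}" for i
    using f that by blast+
  have "z1 \<in> X" using inX[of 1] z m by auto
  then have "poincare_dist (x 0) (x m) \<le> (\<Sum>i<m. poincare_dist (x i) (x (Suc i)))"
    using g(2) inX(2) by (intro poincare_dist_triangle_sum) (auto simp: x_def image_subset_iff)
  also have "\<dots> \<le> (\<Sum>i<m. poincare_dist (a (Suc i)) (b (Suc i)))"
  proof (rule sum_mono)
    fix i assume i: "i \<in> {..<m}"
    have x: "x i = g (f (Suc i) (a (Suc i)))"
      using i z link by (cases "i = 0") (auto simp: x_def)
    have F: "a (Suc i) \<in> unit_disk" "b (Suc i) \<in> unit_disk"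
        "f (Suc i) holomorphic_on unit_disk" "f (Suc i) ` unit_disk \<subseteq> X"
      using f i by auto
    then have "poincare_dist ((g \<circ> f (Suc i)) (a (Suc i))) ((g \<circ> f (Suc i)) (b (Suc i)))
        \<le> poincare_dist (a (Suc i)) (b (Suc i))"
      by (intro poincare_dist_Schwarz_Pick holomorphic_on_compose_gen[OF _ g(1)])
        (use g(2) in \<open>auto simp: image_subset_iff\<close>)
    then show "poincare_dist (x i) (x (Suc i)) \<le> poincare_dist (a (Suc i)) (b (Suc i))"
      unfolding x by (simp add: x_def)
  qed
  also have "\<dots> = (\<Sum>i=1..m. poincare_dist (a i) (b i))"
    using sum.shift_bounds_Suc_ivl[of "\<lambda>i. poincare_dist (a i) (b i)" 0 m]
    by (simp add: lessThan_atLeast0 atLeastLessThanSuc_atLeastAtMost)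
  finally show ?thesis using m z by (simp add: x_def)
qed

text \<open>A single disk \<open>h\<close> through both points makes either distance well behaved:
  it supplies a chain, so the Kobayashi infimum ranges over a nonempty set, and by Schwarz-Pick it
  bounds the set of the Caratheodory supremum.\<close>

lemma poincare_dist_le_kobayashi_or_caratheodory:
  assumes d: "d = kobayashi_dist \<or> d = caratheodory_dist"
    and g: "g holomorphic_on X" "g ` X \<subseteq> unit_disk"
    and h: "h holomorphic_on unit_disk" "h ` unit_disk \<subseteq> X"
    and ab: "a \<in> unit_disk" "b \<in> unit_disk"
  shows "poincare_dist (g (h a)) (g (h b)) \<le> d X (h a) (h b)"
  using d
proof
  assume d: "d = kobayashi_dist"
  show ?thesis
    unfolding d kobayashi_dist_def
  proof (rule cInf_greatest, goal_cases)
    case 1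
    show ?case
      unfolding ex_in_conv[symmetric] mem_Collect_eq
      by (rule exI, rule exI[of _ 1], rule exI[of _ "\<lambda>_. a"], rule exI[of _ "\<lambda>_. b"],
          rule exI[of _ "\<lambda>_. h"], rule conjI, rule refl) (use h ab in auto)
  next
    case (2 L)
    then show ?case
      by (elim CollectE exE conjE, hypsubst) (rule poincare_dist_le_chain[OF g])
  qed
next
  assume d: "d = caratheodory_dist"
  show ?thesis
    unfolding d caratheodory_dist_def
  proof (rule cSup_upper)
    show "bdd_above {poincare_dist (f (h a)) (f (h b)) |f.
        f holomorphic_on X \<and> f ` X \<subseteq> unit_disk}"
    proof (rule bdd_aboveI[of _ "poincare_dist a b"])
      fix L assume "L \<in> {poincare_dist (f (h a)) (f (h b)) |f.
        f holomorphic_on X \<and> f ` X \<subseteq> unit_disk}"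
      then obtain f where f: "f holomorphic_on X" "f ` X \<subseteq> unit_disk"
        and L: "L = poincare_dist ((f \<circ> h) a) ((f \<circ> h) b)"
        by auto
      show "L \<le> poincare_dist a b"
        unfolding L
        by (intro poincare_dist_Schwarz_Pick holomorphic_on_compose_gen[OF h(1) f(1)] h(2) ab)
          (use f(2) h(2) in \<open>auto simp: image_subset_iff\<close>)
    qed
  qed (use g in blast)
qed

lemma kobayashi_dist_unit_disk:
  assumes "a \<in> unit_disk" "b \<in> unit_disk"
  shows "kobayashi_dist unit_disk a b = poincare_dist a b"
proof (rule antisym)
  show "kobayashi_dist unit_disk a b \<le> poincare_dist a b"
    using kobayashi_dist_le[of "\<lambda>z. z" unit_disk a b] assms by auto
  show "poincare_dist a b \<le> kobayashi_dist unit_disk a b"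
    using poincare_dist_le_kobayashi_or_caratheodory[of kobayashi_dist "\<lambda>z. z" unit_disk "\<lambda>z. z" a b]
      assms by auto
qed

section \<open>The annulus and its universal covering\<close>

lemma open_annulus: "open (annulus r)"
proof -
  have "annulus r = ball 0 1 - cball 0 r" by (auto simp: annulus_def)
  then show ?thesis by (simp add: open_Diff)
qed

lemma annulus_subset_unit_disk: "annulus r \<subseteq> unit_disk"
  by (auto simp: annulus_def)

lemma exp_mem_annulus_iff:
  assumes "0 < r"
  shows "exp u \<in> annulus r \<longleftrightarrow> ln r < Re u \<and> Re u < 0"
proof -
  have "r < exp (Re u) \<longleftrightarrow> ln r < Re u" using assms ln_less_cancel_iff[of r "exp (Re u)"] by simp
  then show ?thesis by (simp add: annulus_def)
qed

text \<open>\<open>exp\<close> covers the annulus by a vertical strip, and the Riemann map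
  \<open>k\<close> identifies the convex strip with the disk; \<open>h\<close> is \<open>exp\<close>
  after the inverse of \<open>k\<close>. Continuity of \<open>k\<close> is recorded for a later
  compactness argument.\<close>

lemma annulus_covering:
  assumes r: "0 < r" "r < 1"
  obtains h k where "h holomorphic_on unit_disk" "h ` unit_disk \<subseteq> annulus r"
    "continuous_on {u. ln r < Re u \<and> Re u < 0} k"
    "\<forall>u. ln r < Re u \<and> Re u < 0 \<longrightarrow> k u \<in> unit_disk \<and> h (k u) = exp u"
proof -
  define S where "S = {u. ln r < Re u \<and> Re u < 0}"
  have S: "S = {u. ln r < Re u} \<inter> {u. Re u < 0}" by (auto simp: S_def)
  have "open S" unfolding S
    by (intro open_Int open_halfspace_Re_gt open_halfspace_Re_lt)
  have "convex S" unfolding S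
    by (intro convex_Int convex_halfspace_Re_gt convex_halfspace_Re_lt)
  have "of_real (ln r / 2) \<in> S" "0 \<notin> S" using r by (auto simp: S_def)
  then have "S \<noteq> {}" "S \<noteq> UNIV" by auto
  then obtain k g where k: "k holomorphic_on S" "g holomorphic_on unit_disk"
    "\<forall>z \<in> S. k z \<in> unit_disk \<and> g (k z) = z" "\<forall>z \<in> unit_disk. g z \<in> S \<and> k (g z) = z"
    using Riemann_mapping_theorem[of S] \<open>open S\<close> convex_imp_simply_connected[OF \<open>convex S\<close>] by auto
  show thesis
  proof
    show "(\<lambda>z. exp (g z)) holomorphic_on unit_disk"
      using k by (intro holomorphic_intros)
    show "(\<lambda>z. exp (g z)) ` unit_disk \<subseteq> annulus r"
      using k r by (auto simp: exp_mem_annulus_iff S_def)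
    show "continuous_on {u. ln r < Re u \<and> Re u < 0} k"
      using k holomorphic_on_imp_continuous_on by (auto simp: S_def)
    show "\<forall>u. ln r < Re u \<and> Re u < 0 \<longrightarrow> k u \<in> unit_disk \<and> exp (g (k u)) = exp u"
      using k by (simp add: S_def)
  qed
qed

text \<open>The lift \<open>k \<circ> Ln\<close> shows that the one disk \<open>h\<close> passes
  through any two points of the annulus.\<close>

lemma poincare_dist_le_annulus_dist:
  assumes r: "0 < r" "r < 1" and d: "d = kobayashi_dist \<or> d = caratheodory_dist"
    and g: "g holomorphic_on annulus r" "g ` annulus r \<subseteq> unit_disk"
    and zw: "z \<in> annulus r" "w \<in> annulus r"
  shows "poincare_dist (g z) (g w) \<le> d (annulus r) z w"
proof -
  obtain h k where h: "h holomorphic_on unit_disk" "h ` unit_disk \<subseteq> annulus r"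
    and k: "\<forall>u. ln r < Re u \<and> Re u < 0 \<longrightarrow> k u \<in> unit_disk \<and> h (k u) = exp u"
    by (rule annulus_covering[OF r]) blast
  have lift: "k (Ln x) \<in> unit_disk \<and> h (k (Ln x)) = x" if "x \<in> annulus r" for x
  proof -
    have "x \<noteq> 0" using that r by (auto simp: annulus_def)
    then show ?thesis
      using exp_mem_annulus_iff[OF r(1), of "Ln x"] that k[rule_format, of "Ln x"] by simp
  qed
  obtain a b where "a \<in> unit_disk" "h a = z" "b \<in> unit_disk" "h b = w"
    using lift[OF zw(1)] lift[OF zw(2)] by blast
  then show ?thesis
    using poincare_dist_le_kobayashi_or_caratheodory[OF d g h] by blast
qed

text \<open>\<open>F \<circ> h\<close> vanishes at a lift \<open>a\<close> of \<open>z\<close>, so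
  by Schwarz-Pick \<open>|F|\<close> at a point is at most the pseudohyperbolic distance from
  \<open>a\<close> to any lift of that point. A compact set of lifts covers the circle, so
  \<open>M\<close> is the same for all \<open>F\<close>.\<close>

lemma annulus_circle_bound:
  assumes r: "0 < r" "r < 1" and z: "z \<in> annulus r" and \<rho>: "r < \<rho>" "\<rho> < 1"
  obtains M where "0 < M" "M < 1"
    "\<And>F \<zeta>. F holomorphic_on annulus r \<Longrightarrow> F ` annulus r \<subseteq> unit_disk \<Longrightarrow> F z = 0 \<Longrightarrow>
       norm \<zeta> = \<rho> \<Longrightarrow> norm (F \<zeta>) \<le> M"
proof -
  obtain h k where h: "h holomorphic_on unit_disk" "h ` unit_disk \<subseteq> annulus r"
    and contk: "continuous_on {u. ln r < Re u \<and> Re u < 0} k"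
    and k: "\<forall>u. ln r < Re u \<and> Re u < 0 \<longrightarrow> k u \<in> unit_disk \<and> h (k u) = exp u"
    by (rule annulus_covering[OF r]) blast
  define a where "a = k (Ln z)"
  have "z \<noteq> 0" using z r by (auto simp: annulus_def)
  then have a: "a \<in> unit_disk" "h a = z"
    unfolding a_def using exp_mem_annulus_iff[OF r(1), of "Ln z"] z k[rule_format, of "Ln z"] by simp_all
  \<comment> \<open>One period of the line over the circle; it contains the principal logarithms,
    and the closed interval makes it compact.\<close>
  define C where "C = (\<lambda>t. Complex (ln \<rho>) t) ` {-pi..pi}"
  have C: "C \<subseteq> {u. ln r < Re u \<and> Re u < 0}" using \<rho> r by (auto simp: C_def)
  have "compact C"
    unfolding C_def Complex_eq by (intro compact_continuous_image continuous_intros) auto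
  have kC: "k ` C \<subseteq> unit_disk" using k C by auto
  have "compact (k ` C)"
    by (rule compact_continuous_image[OF continuous_on_subset[OF contk C] \<open>compact C\<close>])
  moreover have "k ` C \<noteq> {}" by (auto simp: C_def)
  moreover have "continuous_on (k ` C) (\<lambda>x. norm (Moebius_function 0 a x))"
    using Moebius_function_holomorphic[of a 0] a
    by (intro continuous_on_norm continuous_on_subset[OF holomorphic_on_imp_continuous_on kC]) simp
  ultimately have "\<exists>x\<in>k ` C. \<forall>y\<in>k ` C.
      norm (Moebius_function 0 a y) \<le> norm (Moebius_function 0 a x)"
    by (rule continuous_attains_sup)
  then obtain x where x: "x \<in> k ` C"
    "\<forall>y\<in>k ` C. norm (Moebius_function 0 a y) \<le> norm (Moebius_function 0 a x)" ..
  \<comment> \<open>The value \<open>1/2\<close> only secures \<open>0 < M\<close>, which allows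
    taking \<open>ln M\<close> later.\<close>
  define M where "M = max (1/2) (norm (Moebius_function 0 a x))"
  show thesis
  proof
    show "0 < M" by (simp add: M_def)
    show "M < 1"
      using Moebius_function_norm_lt_1[of a x] a kC x by (auto simp: M_def)
    fix F and \<zeta> :: complex
    assume F: "F holomorphic_on annulus r" "F ` annulus r \<subseteq> unit_disk" "F z = 0"
      and \<zeta>: "norm \<zeta> = \<rho>"
    have "\<zeta> \<noteq> 0" using \<zeta> \<rho> r by auto
    then have Ln: "Ln \<zeta> = Complex (ln \<rho>) (Arg \<zeta>)"
      using \<zeta> by (simp add: complex_eq_iff Arg_eq_Im_Ln Re_Ln)
    have "Ln \<zeta> \<in> C"
      unfolding Ln C_def using Arg_bounded[of \<zeta>] by auto
    then have "h (k (Ln \<zeta>)) = \<zeta>"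
      using k[rule_format, of "Ln \<zeta>"] C \<open>\<zeta> \<noteq> 0\<close> by auto
    have "k (Ln \<zeta>) \<in> unit_disk" using \<open>Ln \<zeta> \<in> C\<close> kC by auto
    then have "norm (Moebius_function 0 ((F \<circ> h) a) ((F \<circ> h) (k (Ln \<zeta>))))
        \<le> norm (Moebius_function 0 a (k (Ln \<zeta>)))"
      by (intro norm_Schwarz_Pick holomorphic_on_compose_gen[OF h(1) F(1)] h(2) a)
        (use F(2) h(2) in \<open>auto simp: image_subset_iff\<close>)
    also have "\<dots> \<le> M" using x(2)[rule_format, of "k (Ln \<zeta>)"] \<open>Ln \<zeta> \<in> C\<close> by (simp add: M_def max.coboundedI2)
    finally show "norm (F \<zeta>) \<le> M"
      using a F \<open>h (k (Ln \<zeta>)) = \<zeta>\<close> by (simp add: Moebius_function_simple)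
  qed
qed

section \<open>Injective maps of the annulus into the disk\<close>

text \<open>Change of variables, turning the winding number into an integral of a logarithmic
  derivative over the original path.\<close>

lemma winding_number_holomorphic_image:
  assumes f: "f holomorphic_on S" "open S" and \<gamma>: "valid_path \<gamma>" "path_image \<gamma> \<subseteq> S"
    and p: "p \<notin> path_image (f \<circ> \<gamma>)"
  shows "winding_number (f \<circ> \<gamma>) p
    = 1 / (2 * pi * \<i>) * contour_integral \<gamma> (\<lambda>w. deriv f w / (f w - p))"
proof -
  have "f analytic_on S" using f by (simp add: analytic_on_open)
  then show ?thesis
    using valid_path_compose_holomorphic[OF \<gamma>(1) f \<gamma>(2)] p
    by (simp add: winding_number_valid_path contour_integral_comp_analyticW[OF _ \<gamma>])
qed

lemma circle_subset_annulus:
  assumes "0 < r" "r < \<rho>" "\<rho> < 1"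
  shows "sphere 0 \<rho> \<subseteq> annulus r"
  using assms by (auto simp: annulus_def)

lemma homotopic_loops_circlepath_annulus:
  assumes r: "0 < r" and \<rho>: "r < \<rho>" "\<rho> < 1" and \<sigma>: "r < \<sigma>" "\<sigma> < 1"
  shows "homotopic_loops (annulus r) (circlepath 0 \<rho>) (circlepath 0 \<sigma>)"
proof (rule homotopic_loops_linear)
  fix t :: real
  show "closed_segment (circlepath 0 \<rho> t) (circlepath 0 \<sigma> t) \<subseteq> annulus r"
  proof
    fix x assume "x \<in> closed_segment (circlepath 0 \<rho> t) (circlepath 0 \<sigma> t)"
    then obtain s where s: "0 \<le> s" "s \<le> 1"
      and x: "x = (1 - s) *\<^sub>R circlepath 0 \<rho> t + s *\<^sub>R circlepath 0 \<sigma> t"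
      by (auto simp: in_segment)
    have "x = of_real ((1 - s) * \<rho> + s * \<sigma>) * exp (2 * of_real pi * \<i> * of_real t)"
      unfolding x circlepath by (simp add: scaleR_conv_of_real algebra_simps)
    then have "norm x = \<bar>(1 - s) * \<rho> + s * \<sigma>\<bar>"
      by (simp only: norm_mult norm_of_real) simp
    moreover have "(1 - s) * \<rho> + s * \<sigma> \<in> {r<..<1}"
      using convexD[of "{r<..<1}" \<rho> \<sigma> "1 - s" s] \<rho> \<sigma> s by simp
    ultimately show "x \<in> annulus r" using r by (simp add: annulus_def)
  qed
qed (auto simp: valid_path_imp_path)

text \<open>
  Otherwise the circle of radius \<open>\<rho>\<close> would be the image of a loop in a disk under the
  inverse of \<open>f\<close>, and hence null-homotopic in the annulus.
\<close>
lemma covered_disk_radius_le: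
  assumes r: "0 < r" and \<rho>: "r < \<rho>" "\<rho> < 1"
    and f: "f holomorphic_on annulus r" "inj_on f (annulus r)"
    and t: "ball 0 t \<subseteq> f ` annulus r"
    and M: "\<And>\<zeta>. norm \<zeta> = \<rho> \<Longrightarrow> norm (f \<zeta>) \<le> M"
  shows "t \<le> M"
proof (rule ccontr)
  assume "\<not> t \<le> M"
  then have tM: "M < t" by simp
  obtain g where g: "g holomorphic_on f ` annulus r" "\<And>z. z \<in> annulus r \<Longrightarrow> g (f z) = z"
    using holomorphic_has_inverse[OF f(1) open_annulus f(2)] by metis
  define \<gamma> where "\<gamma> = f \<circ> circlepath 0 \<rho>"
  have circ: "path_image (circlepath 0 \<rho>) \<subseteq> annulus r"
    using circle_subset_annulus[OF r \<rho>] r \<rho> by simp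
  have \<gamma>: "valid_path \<gamma>"
    unfolding \<gamma>_def by (rule valid_path_compose_holomorphic[OF _ f(1) open_annulus circ]) auto
  have im: "path_image \<gamma> \<subseteq> ball 0 t"
  proof -
    have "norm (f \<zeta>) < t" if "norm \<zeta> = \<rho>" for \<zeta> using M[OF that] tM by simp
    then show ?thesis using r \<rho> by (auto simp: \<gamma>_def path_image_compose)
  qed
  have circ': "circlepath 0 \<rho> s \<in> annulus r" for s
    using r \<rho> by (simp add: circlepath annulus_def norm_mult)
  have g\<gamma>: "g \<circ> \<gamma> = circlepath 0 \<rho>"
    by (simp add: fun_eq_iff \<gamma>_def g(2) circ')
  have gh: "g holomorphic_on ball 0 t" by (rule holomorphic_on_subset[OF g(1) t])
  \<comment> \<open>The annulus omits 0, so \<open>g\<close> has a holomorphic logarithmic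
    derivative on the disk. Its integral over \<gamma> vanishes by Cauchy, although
    \<open>g \<circ> \<gamma>\<close> is the circle itself, with winding number 1.\<close>
  have "0 \<notin> g ` ball 0 t"
  proof
    assume "0 \<in> g ` ball 0 t"
    then obtain w where w: "w \<in> ball 0 t" "g w = 0" by (metis imageE)
    then obtain z where "z \<in> annulus r" "w = f z" using t by blast
    then show False using g(2)[of z] w r by (simp add: annulus_def)
  qed
  then have "(\<lambda>w. deriv g w / (g w - 0)) holomorphic_on ball 0 t"
    by (intro holomorphic_intros gh) auto
  then have "contour_integral \<gamma> (\<lambda>w. deriv g w / (g w - 0)) = 0"
    by (intro contour_integral_unique Cauchy_theorem_disc_simple[OF _ \<gamma> im])
      (auto simp: \<gamma>_def pathfinish_compose pathstart_compose)
  moreover have "winding_number (g \<circ> \<gamma>) 0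
      = 1 / (2 * pi * \<i>) * contour_integral \<gamma> (\<lambda>w. deriv g w / (g w - 0))"
    by (rule winding_number_holomorphic_image[OF gh _ \<gamma> im]) (use r \<rho> in \<open>auto simp: g\<gamma>\<close>)
  moreover have "winding_number (g \<circ> \<gamma>) 0 = 1"
    using r \<rho> unfolding g\<gamma> by (intro winding_number_circlepath_centre) simp
  ultimately show False by simp
qed

text \<open>The argument principle on the annulus, with the inner boundary contributing \<open>c\<close>.\<close>
lemma winding_number_image_circle:
  assumes r: "0 < r" and f: "f holomorphic_on annulus r" "inj_on f (annulus r)"
    and x: "x \<in> annulus r"
  obtains c where "\<And>\<rho>. r < \<rho> \<Longrightarrow> \<rho> < 1 \<Longrightarrow> \<rho> \<noteq> norm x \<Longrightarrow>
    winding_number (f \<circ> circlepath 0 \<rho>) (f x) = (if norm x < \<rho> then 1 else 0) + c"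
proof -
  have "deriv f x \<noteq> 0"
    by (rule holomorphic_injective_imp_regular[OF f(1) open_annulus f(2) x])
  \<comment> \<open>The difference quotient, zero-free by injectivity and
    \<open>deriv f x \<noteq> 0\<close>. The factorization \<open>f z - f x = (z - x) * u z\<close>
    splits the logarithmic derivative.\<close>
  define u where "u = (\<lambda>z. if z = x then deriv f x else (f z - f x) / (z - x))"
  have fdx: "f field_differentiable at x"
    using f(1) x open_annulus holomorphic_on_imp_differentiable_at by blast
  have u: "u holomorphic_on annulus r"
  proof (rule pole_theorem_open_0[of "\<lambda>z. f z - f x" _ x])
    show "(\<lambda>z. f z - f x) holomorphic_on annulus r" by (intro holomorphic_intros f)
    show "u x = deriv (\<lambda>z. f z - f x) x" using fdx by (simp add: u_def)
  qed (auto simp: u_def open_annulus)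
  have u0: "u z \<noteq> 0" if "z \<in> annulus r" for z
    using that x f(2) \<open>deriv f x \<noteq> 0\<close> by (auto simp: u_def inj_on_def)
  have fu: "f z = f x + (z - x) * u z" for z by (simp add: u_def)
  have log_deriv: "deriv f z / (f z - f x) = 1 / (z - x) + deriv u z / u z"
    if z: "z \<in> annulus r" "z \<noteq> x" for z
  proof -
    have "(u has_field_derivative deriv u z) (at z)"
      using u z open_annulus holomorphic_derivI by blast
    then have "((\<lambda>z. f x + (z - x) * u z) has_field_derivative u z + (z - x) * deriv u z) (at z)"
      by (auto intro!: derivative_eq_intros)
    then have "deriv f z = u z + (z - x) * deriv u z"
      unfolding fu[symmetric] by (rule DERIV_imp_deriv)
    moreover have "f z - f x = (z - x) * u z" by (simp add: u_def)
    ultimately show ?thesis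
      using z u0[OF z(1)] by (simp only:) (simp add: add_divide_distrib)
  qed
  have du: "(\<lambda>z. deriv u z / u z) holomorphic_on annulus r"
    using u0 by (intro holomorphic_intros u open_annulus)
  \<comment> \<open>All concentric circles are homotopic in the annulus, so the integral of
    \<open>deriv u / u\<close> is the same on each; the radius \<open>(r + 1) / 2\<close> is one
    choice.\<close>
  define c where "c = 1 / (2 * pi * \<i>) *
    contour_integral (circlepath 0 ((r + 1) / 2)) (\<lambda>z. deriv u z / u z)"
  show thesis
  proof
    fix \<rho> assume \<rho>: "r < \<rho>" "\<rho> < 1" "\<rho> \<noteq> norm x"
    let ?C = "circlepath 0 \<rho>"
    have circ: "path_image ?C \<subseteq> annulus r"
      using circle_subset_annulus[OF r \<rho>(1,2)] r \<rho> by simp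
    have xC: "x \<notin> path_image ?C" using \<rho> r by auto
    have "f x \<notin> path_image (f \<circ> ?C)"
      using xC inj_on_image_mem_iff[OF f(2) x circ] by (simp add: path_image_compose)
    then have "winding_number (f \<circ> ?C) (f x)
        = 1 / (2 * pi * \<i>) * contour_integral ?C (\<lambda>z. deriv f z / (f z - f x))"
      by (rule winding_number_holomorphic_image[OF f(1) open_annulus valid_path_circlepath circ])
    also have "contour_integral ?C (\<lambda>z. deriv f z / (f z - f x))
        = contour_integral ?C (\<lambda>z. 1 / (z - x) + deriv u z / u z)"
    proof (rule contour_integral_eq)
      fix z assume "z \<in> path_image ?C"
      then show "deriv f z / (f z - f x) = 1 / (z - x) + deriv u z / u z"
        using circ xC by (intro log_deriv) blast+
    qed
    also have "\<dots> = contour_integral ?C (\<lambda>z. 1 / (z - x)) + contour_integral ?C (\<lambda>z. deriv u z / u z)"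
    proof (rule contour_integral_add)
      show "(\<lambda>z. 1 / (z - x)) contour_integrable_on ?C"
        using has_contour_integral_winding_number[OF valid_path_circlepath xC]
        by (auto simp: contour_integrable_on_def)
      show "(\<lambda>z. deriv u z / u z) contour_integrable_on ?C"
        by (rule contour_integrable_holomorphic_simple[OF du open_annulus _ circ]) simp
    qed
    also have "contour_integral ?C (\<lambda>z. deriv u z / u z)
        = contour_integral (circlepath 0 ((r + 1) / 2)) (\<lambda>z. deriv u z / u z)"
      using r \<rho> by (intro Cauchy_theorem_homotopic_loops[OF _ open_annulus du]
          homotopic_loops_circlepath_annulus) auto
    also have "1 / (2 * pi * \<i>) * (contour_integral ?C (\<lambda>z. 1 / (z - x)) + \<dots>)
        = winding_number ?C x + c"
      by (simp add: winding_number_valid_path[OF valid_path_circlepath xC] c_def algebra_simps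
          add_divide_distrib)
    also have "winding_number ?C x = (if norm x < \<rho> then 1 else 0)"
    proof (cases "norm x < \<rho>")
      case True
      then show ?thesis by (simp add: winding_number_circlepath)
    next
      case False
      then have "winding_number ?C x = 0"
        using \<rho> r by (intro winding_number_zero_outside[of _ "cball 0 \<rho>"]) (auto simp: valid_path_imp_path)
      then show ?thesis using False by simp
    qed
    finally show "winding_number (f \<circ> ?C) (f x) = (if norm x < \<rho> then 1 else 0) + c" .
  qed
qed

lemma connected_norm_between: "connected {x::complex. s < norm x \<and> norm x < t}"
  using connected_annulus(1)[where 'N = complex and a = 0, of s t] by simp

text \<open>A one-sided maximum principle that records the orientation of \<open>f\<close> without
  boundary values: the identity has this property, the inversion \<open>r / \<zeta>\<close> does
  not.\<close>

definition inner_bounded :: "real \<Rightarrow> (complex \<Rightarrow> complex) \<Rightarrow> bool" where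
  "inner_bounded r f \<longleftrightarrow> (\<forall>\<rho> M. r < \<rho> \<longrightarrow> \<rho> < 1 \<longrightarrow>
     (\<forall>\<zeta>. norm \<zeta> = \<rho> \<longrightarrow> norm (f \<zeta>) \<le> M) \<longrightarrow>
     (\<forall>\<zeta>\<in>annulus r. norm \<zeta> \<le> \<rho> \<longrightarrow> norm (f \<zeta>) \<le> M))"

text \<open>
  The winding number of the image of a circle jumps by one between the two sides of that
  image, so it cannot vanish on both sides.
\<close>
lemma annulus_orientation:
  assumes r: "0 < r" "r < 1" and f: "f holomorphic_on annulus r" "inj_on f (annulus r)"
  shows "inner_bounded r f \<or>
         (\<forall>\<rho> M. r < \<rho> \<longrightarrow> \<rho> < 1 \<longrightarrow> (\<forall>\<zeta>. norm \<zeta> = \<rho> \<longrightarrow> norm (f \<zeta>) \<le> M) \<longrightarrow>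
            (\<forall>\<zeta>\<in>annulus r. \<rho> \<le> norm \<zeta> \<longrightarrow> norm (f \<zeta>) \<le> M))"
proof (rule ccontr)
  assume "\<not> ?thesis"
  then obtain \<rho>1 M1 a \<rho>2 M2 b where
    1: "r < \<rho>1" "\<rho>1 < 1" "\<forall>\<zeta>. norm \<zeta> = \<rho>1 \<longrightarrow> norm (f \<zeta>) \<le> M1"
      "a \<in> annulus r" "norm a \<le> \<rho>1" "M1 < norm (f a)" and
    2: "r < \<rho>2" "\<rho>2 < 1" "\<forall>\<zeta>. norm \<zeta> = \<rho>2 \<longrightarrow> norm (f \<zeta>) \<le> M2"
      "b \<in> annulus r" "\<rho>2 \<le> norm b" "M2 < norm (f b)"
    by (auto simp: inner_bounded_def not_le)
  define W where "W = (\<lambda>\<rho> x. winding_number (f \<circ> circlepath 0 \<rho>) (f x))"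
  \<comment> \<open>The image curve stays in \<open>cball 0 M\<close>, and the winding number
    vanishes outside a convex set containing it.\<close>
  have far: "W \<rho> x = 0"
    if "r < \<rho>" "\<rho> < 1" "\<forall>\<zeta>. norm \<zeta> = \<rho> \<longrightarrow> norm (f \<zeta>) \<le> M" "M < norm (f x)" for \<rho> M x
    unfolding W_def
  proof (rule winding_number_zero_outside)
    have circ: "path_image (circlepath 0 \<rho>) \<subseteq> annulus r"
      using circle_subset_annulus[OF r(1) that(1,2)] r that by simp
    show "path (f \<circ> circlepath 0 \<rho>)"
      by (rule valid_path_imp_path[OF valid_path_compose_holomorphic[OF _ f(1) open_annulus circ]]) simp
    show "path_image (f \<circ> circlepath 0 \<rho>) \<subseteq> cball 0 M"
      using that r by (auto simp: path_image_compose)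
  qed (use that in \<open>auto simp: pathfinish_compose pathstart_compose\<close>)
  \<comment> \<open>By injectivity the image of a connected set that misses the circle misses the
    image curve.\<close>
  have const: "W \<rho> x = W \<rho> y"
    if "r < \<rho>" "\<rho> < 1" and S: "S \<subseteq> annulus r" "connected S" "S \<inter> sphere 0 \<rho> = {}" "x \<in> S" "y \<in> S"
    for \<rho> x y S
    unfolding W_def
  proof (rule winding_number_eq[of _ _ "f ` S"])
    have circ: "path_image (circlepath 0 \<rho>) \<subseteq> annulus r"
      using circle_subset_annulus[OF r(1) that(1,2)] r that by simp
    show "path (f \<circ> circlepath 0 \<rho>)"
      by (rule valid_path_imp_path[OF valid_path_compose_holomorphic[OF _ f(1) open_annulus circ]]) simp
    have "continuous_on S f"
      using f(1) S(1) holomorphic_on_imp_continuous_on continuous_on_subset by blast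
    then show "connected (f ` S)" using S(2) by (rule connected_continuous_image)
    have "f ` S \<inter> f ` sphere 0 \<rho> = f ` (S \<inter> sphere 0 \<rho>)"
      using S(1) circle_subset_annulus[OF r(1) that(1,2)] inj_on_image_Int[OF f(2)] by metis
    then show "f ` S \<inter> path_image (f \<circ> circlepath 0 \<rho>) = {}"
      using S(3) r that by (simp add: path_image_compose)
  qed (use S in \<open>auto simp: pathfinish_compose pathstart_compose\<close>)
  have "norm a \<noteq> \<rho>1" using 1 by auto
  have "norm b \<noteq> \<rho>2" using 2 by auto
  \<comment> \<open>At \<open>a\<close> the circle of radius \<rho>1 already gives 0 although it
    lies beyond \<open>a\<close>, so \<open>c = -1\<close> and every circle beyond \<open>a\<close>
    gives 0. A circle \<sigma> beyond \<open>a\<close>, \<open>x\<close> and \<rho> carries this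
    from \<open>a\<close> to \<open>x\<close>, and \<sigma> may then be replaced by \<rho>.\<close>
  have inner: "W \<rho> x = 0" if x: "x \<in> annulus r" and \<rho>: "r < \<rho>" "\<rho> < 1" "norm x < \<rho>" for x \<rho>
  proof -
    obtain c where c: "\<And>\<rho>. r < \<rho> \<Longrightarrow> \<rho> < 1 \<Longrightarrow> \<rho> \<noteq> norm a \<Longrightarrow>
        W \<rho> a = (if norm a < \<rho> then 1 else 0) + c"
      unfolding W_def by (rule winding_number_image_circle[OF r(1) f 1(4)]) blast
    have "W \<rho>1 a = 0" using far 1 by blast
    then have c1: "c = - 1" using c[of \<rho>1] 1 \<open>norm a \<noteq> \<rho>1\<close> by (simp add: eq_neg_iff_add_eq_0 add.commute)
    obtain c' where c': "\<And>\<rho>. r < \<rho> \<Longrightarrow> \<rho> < 1 \<Longrightarrow> \<rho> \<noteq> norm x \<Longrightarrow>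
        W \<rho> x = (if norm x < \<rho> then 1 else 0) + c'"
      unfolding W_def by (rule winding_number_image_circle[OF r(1) f x]) blast
    have "max \<rho> (max (norm x) (norm a)) < 1" using \<rho> x 1(4) by (simp add: annulus_def)
    then obtain \<sigma> where "max \<rho> (max (norm x) (norm a)) < \<sigma>" "\<sigma> < 1" using dense by blast
    then have \<sigma>: "r < \<sigma>" "\<sigma> < 1" "norm a < \<sigma>" "norm x < \<sigma>" using \<rho>(1) by simp_all
    have "W \<sigma> x = W \<sigma> a"
      by (rule const[of _ "{x. r < norm x \<and> norm x < \<sigma>}"])
        (use \<sigma> x 1(4) in \<open>auto simp: annulus_def connected_norm_between\<close>)
    also have "\<dots> = 0" using c[of \<sigma>] \<sigma> c1 by simp
    finally show ?thesis using c'[of \<sigma>] c'[of \<rho>] \<sigma> \<rho> by simp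
  qed
  \<comment> \<open>The mirror image: at \<open>b\<close> the constant is 0, and a small circle
    \<sigma> carries this to \<open>x\<close>.\<close>
  have outer: "W \<rho> x = 0" if x: "x \<in> annulus r" and \<rho>: "r < \<rho>" "\<rho> < 1" "\<rho> < norm x" for x \<rho>
  proof -
    obtain c where c: "\<And>\<rho>. r < \<rho> \<Longrightarrow> \<rho> < 1 \<Longrightarrow> \<rho> \<noteq> norm b \<Longrightarrow>
        W \<rho> b = (if norm b < \<rho> then 1 else 0) + c"
      unfolding W_def by (rule winding_number_image_circle[OF r(1) f 2(4)]) blast
    have "W \<rho>2 b = 0" using far 2 by blast
    then have c1: "c = 0" using c[of \<rho>2] 2 \<open>norm b \<noteq> \<rho>2\<close> by simp
    obtain c' where c': "\<And>\<rho>. r < \<rho> \<Longrightarrow> \<rho> < 1 \<Longrightarrow> \<rho> \<noteq> norm x \<Longrightarrow>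
        W \<rho> x = (if norm x < \<rho> then 1 else 0) + c'"
      unfolding W_def by (rule winding_number_image_circle[OF r(1) f x]) blast
    have "r < min \<rho> (min (norm x) (norm b))" using \<rho> x 2(4) by (simp add: annulus_def)
    then obtain \<sigma> where "r < \<sigma>" "\<sigma> < min \<rho> (min (norm x) (norm b))" using dense by blast
    then have \<sigma>: "r < \<sigma>" "\<sigma> < 1" "\<sigma> < norm b" "\<sigma> < norm x" using \<rho>(2) by simp_all
    have "W \<sigma> x = W \<sigma> b"
      by (rule const[of _ "{x. \<sigma> < norm x \<and> norm x < 1}"])
        (use \<sigma> x 2(4) in \<open>auto simp: annulus_def connected_norm_between\<close>)
    also have "\<dots> = 0" using c[of \<sigma>] \<sigma> c1 by simp
    finally show ?thesis using c'[of \<sigma>] c'[of \<rho>] \<sigma> \<rho> by simp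
  qed
  \<comment> \<open>Any point with a circle on either side yields the contradiction: both winding
    numbers are 0, yet they differ by 1.\<close>
  define x where "x = complex_of_real ((r + 1) / 2)"
  have nx: "norm x = (r + 1) / 2" unfolding x_def norm_of_real using r by simp
  then have x: "x \<in> annulus r" using r by (simp add: annulus_def)
  obtain c where c: "\<And>\<rho>. r < \<rho> \<Longrightarrow> \<rho> < 1 \<Longrightarrow> \<rho> \<noteq> norm x \<Longrightarrow>
      W \<rho> x = (if norm x < \<rho> then 1 else 0) + c"
    unfolding W_def by (rule winding_number_image_circle[OF r(1) f x]) blast
  obtain \<sigma> where \<sigma>: "norm x < \<sigma>" "\<sigma> < 1" using dense[of "norm x" 1] x by (auto simp: annulus_def)
  obtain \<tau> where \<tau>: "r < \<tau>" "\<tau> < norm x" using dense[of r "norm x"] x by (auto simp: annulus_def)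
  have "W \<sigma> x = 0" using x \<sigma> by (intro inner) (auto simp: annulus_def)
  moreover have "W \<tau> x = 0" using x \<tau> by (intro outer) (auto simp: annulus_def)
  ultimately show False
    using c[of \<sigma>] c[of \<tau>] \<sigma> \<tau> x by (simp add: annulus_def)
qed

section \<open>The inversion of the annulus\<close>

lemma annulus_inversion:
  assumes "0 < r" "z \<in> annulus r"
  shows "of_real r / z \<in> annulus r"
proof -
  have "r < norm z" "norm z < 1" using assms by (auto simp: annulus_def)
  moreover have "0 < norm z" using assms calculation by linarith
  ultimately have "r < r / norm z" "r / norm z < 1"
    using assms by (simp_all add: pos_less_divide_eq)
  then show ?thesis using assms by (simp add: annulus_def norm_divide)
qed

lemma annulus_inversion_involution:
  assumes "0 < r"
  shows "of_real r / (of_real r / z) = (z :: complex)"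
  using assms by simp

lemma holomorphic_on_annulus_inversion:
  assumes "0 < r"
  shows "(\<lambda>\<zeta>. of_real r / \<zeta>) holomorphic_on annulus r"
  using assms by (intro holomorphic_intros) (auto simp: annulus_def)

lemma holomorphic_on_compose_annulus_inversion:
  assumes "0 < r" "f holomorphic_on annulus r"
  shows "(\<lambda>\<zeta>. f (of_real r / \<zeta>)) holomorphic_on annulus r"
  using holomorphic_on_compose_gen[OF holomorphic_on_annulus_inversion[OF assms(1)] assms(2)]
    annulus_inversion[OF assms(1)] by (auto simp: o_def)

text \<open>The inversion takes the circle of radius \<rho> to the one of radius
  \<open>r / \<rho>\<close> and swaps its two sides, so the outer alternative for \<open>f\<close>
  becomes the inner one.\<close>

lemma inner_bounded_or_inversion:
  assumes r: "0 < r" "r < 1" and f: "f holomorphic_on annulus r" "inj_on f (annulus r)"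
  shows "inner_bounded r f \<or> inner_bounded r (\<lambda>\<zeta>. f (of_real r / \<zeta>))"
  using annulus_orientation[OF r f]
proof
  assume out: "\<forall>\<rho> M. r < \<rho> \<longrightarrow> \<rho> < 1 \<longrightarrow> (\<forall>\<zeta>. norm \<zeta> = \<rho> \<longrightarrow> norm (f \<zeta>) \<le> M) \<longrightarrow>
            (\<forall>\<zeta>\<in>annulus r. \<rho> \<le> norm \<zeta> \<longrightarrow> norm (f \<zeta>) \<le> M)"
  have "inner_bounded r (\<lambda>\<zeta>. f (of_real r / \<zeta>))"
    unfolding inner_bounded_def
  proof (intro allI impI ballI)
    fix \<rho> M and \<zeta> :: complex
    assume \<rho>: "r < \<rho>" "\<rho> < 1" and M: "\<forall>\<zeta>. norm \<zeta> = \<rho> \<longrightarrow> norm (f (of_real r / \<zeta>)) \<le> M"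
      and \<zeta>: "\<zeta> \<in> annulus r" "norm \<zeta> \<le> \<rho>"
    have "norm (f x) \<le> M" if "norm x = r / \<rho>" for x
    proof -
      have "norm (of_real r / x) = \<rho>" using that r \<rho> by (simp add: norm_divide)
      then show ?thesis
        using M annulus_inversion_involution[OF r(1), of x] by metis
    qed
    moreover have "r < r / \<rho>" "r / \<rho> < 1" using r \<rho> by (auto simp: field_simps)
    moreover have "r / \<rho> \<le> norm (of_real r / \<zeta>)"
      using \<zeta> r by (auto simp: norm_divide annulus_def intro!: divide_left_mono mult_pos_pos)
    ultimately show "norm (f (of_real r / \<zeta>)) \<le> M"
      using out annulus_inversion[OF r(1) \<zeta>(1)] by blast
  qed
  then show ?thesis ..
qed simp

section \<open>Competitors that improve on an injective map\<close>

text \<open>Triangle inequality through 0. It makes the inclusion a sufficient competitor for points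
  \<open>w\<close> near the outer boundary.\<close>

lemma norm_Moebius_ge:
  assumes z: "z \<in> unit_disk" and w: "w \<in> unit_disk" and T: "0 \<le> T" "T < 1"
    and le: "artanh (norm z) + artanh T \<le> artanh (norm w)"
  shows "T \<le> norm (Moebius_function 0 z w)"
proof -
  have "poincare_dist 0 w \<le> poincare_dist 0 z + poincare_dist z w"
    using z w by (intro poincare_dist_triangle) auto
  then have "artanh T \<le> artanh (norm (Moebius_function 0 z w))"
    using le z w by (simp add: poincare_dist_0) (simp add: poincare_dist_eq)
  then show ?thesis
    using T z w by (subst (asm) artanh_le_iff_real) (auto simp: Moebius_function_norm_lt_1)
qed

text \<open>
  An inner bounded map is not extremal for the Caratheodory distance: multiplying it by
  \<open>exp (\<epsilon> * (e / \<zeta> - \<beta>))\<close>, where \<open>e / w > 0\<close>, enlarges it at \<open>w\<close> and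
  shrinks it near the outer boundary. Points \<open>w\<close> close to the outer boundary are far
  from \<open>z\<close> already for the distance of the disk.
\<close>
lemma improve_inner_bounded:
  assumes r: "0 < r" "r < 1" and z: "z \<in> annulus r" and T: "0 < T" "T < 1"
  obtains \<kappa> where "\<kappa> > 1"
    "\<forall>f w. f holomorphic_on annulus r \<and> f ` annulus r \<subseteq> unit_disk \<and> f z = 0 \<and>
       inner_bounded r f \<and> w \<in> annulus r \<longrightarrow>
       (\<exists>F. F holomorphic_on annulus r \<and> F ` annulus r \<subseteq> unit_disk \<and>
          min (\<kappa> * norm (f w)) T \<le> norm (Moebius_function 0 (F z) (F w)))"
proof -
  \<comment> \<open>The second entry puts every \<open>w\<close> with \<open>|w| > R\<close> at
    distance at least \<open>2 * artanh T\<close> from \<open>z\<close> in the disk; the first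
    secures \<open>r < R\<close>.\<close>
  define R where "R = max ((r + 1) / 2) (tanh (artanh (norm z) + artanh T))"
  have R: "r < R" "0 < R" "R < 1"
    using r by (simp_all add: R_def tanh_real_lt_1 less_max_iff_disj)
  \<comment> \<open>Strictly between 1 and \<open>1 / R\<close>, so that the factor exceeds 1 at
    \<open>w\<close> when \<open>|w| \<le> R\<close> and is at most 1 in modulus from the radius
    \<open>\<rho> = 1 / \<beta> < 1\<close> outwards.\<close>
  define \<beta> where "\<beta> = (1 + 1 / R) / 2"
  have \<beta>: "1 < \<beta>" "\<beta> < 1 / R" using R by (auto simp: \<beta>_def field_simps)
  define \<rho> where "\<rho> = 1 / \<beta>"
  have \<rho>: "R < \<rho>" "\<rho> < 1" using \<beta> R by (auto simp: \<rho>_def field_simps)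
  obtain M where M: "0 < M" "M < 1"
    "\<And>F \<zeta>. F holomorphic_on annulus r \<Longrightarrow> F ` annulus r \<subseteq> unit_disk \<Longrightarrow> F z = 0 \<Longrightarrow>
       norm \<zeta> = \<rho> \<Longrightarrow> norm (F \<zeta>) \<le> M"
    by (rule annulus_circle_bound[OF r z, of \<rho>]) (use \<rho> R in auto)
  \<comment> \<open>With this choice \<open>exp (\<epsilon> / r) * M\<close> is the square root of
    \<open>M\<close>, hence less than 1.\<close>
  define \<epsilon> where "\<epsilon> = - (r / 2) * ln M"
  have \<epsilon>: "\<epsilon> > 0" using M r by (simp add: \<epsilon>_def mult_less_0_iff)
  have "exp (\<epsilon> / r) * M = exp (\<epsilon> / r + ln M)" using M by (simp add: exp_add)
  also have "\<epsilon> / r + ln M < 0" using r M by (simp add: \<epsilon>_def)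
  finally have \<epsilon>M: "exp (\<epsilon> / r) * M < 1" by simp
  \<comment> \<open>The least value of the factor at \<open>w\<close> over all
    \<open>|w| \<le> R\<close>, attained for \<open>|w| = R\<close>.\<close>
  define \<kappa> where "\<kappa> = exp (\<epsilon> * (1 / R - \<beta>))"
  have \<kappa>: "\<kappa> > 1" using \<epsilon> \<beta> by (simp add: \<kappa>_def)
  have "\<exists>F. F holomorphic_on annulus r \<and> F ` annulus r \<subseteq> unit_disk \<and>
          min (\<kappa> * norm (f w)) T \<le> norm (Moebius_function 0 (F z) (F w))"
    if f: "f holomorphic_on annulus r" "f ` annulus r \<subseteq> unit_disk" "f z = 0"
      and inner: "inner_bounded r f" and w: "w \<in> annulus r" for f w
  proof (cases "R < norm w")
    case True
    have "tanh (artanh (norm z) + artanh T) \<le> norm w" using True by (simp add: R_def)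
    moreover have "tanh (artanh (norm w)) = norm w"
      using w by (intro tanh_artanh_real) (simp add: annulus_def)
    ultimately have "artanh (norm z) + artanh T \<le> artanh (norm w)"
      by (metis tanh_real_le_iff)
    then have "T \<le> norm (Moebius_function 0 z w)"
      using z w T by (intro norm_Moebius_ge) (auto simp: annulus_def)
    then have "min (\<kappa> * norm (f w)) T \<le> norm (Moebius_function 0 z w)" by simp
    then show ?thesis
      using annulus_subset_unit_disk by (intro exI[of _ "\<lambda>\<zeta>. \<zeta>"]) auto
  next
    case False
    define e where "e = w / of_real (norm w)"
    have w0: "w \<noteq> 0" using w r by (auto simp: annulus_def)
    have e: "norm e = 1" using w0 by (simp add: e_def norm_divide)
    define F where "F = (\<lambda>\<zeta>. f \<zeta> * exp (of_real \<epsilon> * (e / \<zeta> - of_real \<beta>)))"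
    have F_norm: "norm (F \<zeta>) = norm (f \<zeta>) * exp (\<epsilon> * (Re (e / \<zeta>) - \<beta>))" for \<zeta>
      by (simp add: F_def norm_mult)
    have "F holomorphic_on annulus r"
      unfolding F_def using f r by (intro holomorphic_intros) (auto simp: annulus_def)
    moreover have "norm (F \<zeta>) < 1" if \<zeta>: "\<zeta> \<in> annulus r" for \<zeta>
    proof -
      have \<zeta>n: "r < norm \<zeta>" "0 < norm \<zeta>" using \<zeta> r by (auto simp: annulus_def)
      have Re: "Re (e / \<zeta>) \<le> 1 / norm \<zeta>"
        using complex_Re_le_cmod[of "e / \<zeta>"] by (simp add: norm_divide e)
      have f1: "norm (f \<zeta>) < 1" using f(2) \<zeta> by auto
      show ?thesis
      \<comment> \<open>Inside the circle of radius \<rho>, inner boundedness extends the bound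
        \<open>M\<close> from the circle, which leaves room for a factor up to
        \<open>exp (\<epsilon> / r)\<close>; outside, the factor does not increase
        \<open>|f|\<close>.\<close>
      proof (cases "norm \<zeta> \<le> \<rho>")
        case True
        have "norm (f \<zeta>) \<le> M"
          using inner[unfolded inner_bounded_def] \<rho> R M(3)[OF f] \<zeta> True by (meson less_trans)
        moreover have "Re (e / \<zeta>) - \<beta> \<le> 1 / r"
          using Re \<beta> \<zeta>n r frac_le[of 1 1 r "norm \<zeta>"] by simp
        then have "exp (\<epsilon> * (Re (e / \<zeta>) - \<beta>)) \<le> exp (\<epsilon> / r)"
          using \<epsilon> mult_left_mono[of _ "1 / r" \<epsilon>] by force
        ultimately have "norm (F \<zeta>) \<le> M * exp (\<epsilon> / r)"
          unfolding F_norm using M by (intro mult_mono) auto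
        then show ?thesis using \<epsilon>M by (simp add: mult.commute)
      next
        case False
        then have "1 / norm \<zeta> \<le> \<beta>"
          using \<beta> \<zeta>n by (simp add: \<rho>_def field_simps)
        then have "exp (\<epsilon> * (Re (e / \<zeta>) - \<beta>)) \<le> 1"
          using \<epsilon> Re by (simp add: mult_nonneg_nonpos)
        then have "norm (F \<zeta>) \<le> norm (f \<zeta>) * 1"
          unfolding F_norm by (intro mult_left_mono) auto
        then show ?thesis using f1 by simp
      qed
    qed
    moreover have "min (\<kappa> * norm (f w)) T \<le> norm (Moebius_function 0 (F z) (F w))"
    proof -
      have "e / w = of_real (1 / norm w)" using w0 by (simp add: e_def)
      then have "Re (e / w) = 1 / norm w" by (simp only: Re_complex_of_real)
      moreover have "1 / R \<le> 1 / norm w" using False w0 R by (intro divide_left_mono) auto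
      ultimately have "\<kappa> \<le> exp (\<epsilon> * (Re (e / w) - \<beta>))"
        using \<epsilon> by (simp add: \<kappa>_def)
      then have "\<kappa> * norm (f w) \<le> norm (F w)"
        unfolding F_norm by (subst mult.commute) (rule mult_left_mono, auto)
      then show ?thesis by (simp add: F_def f Moebius_function_simple)
    qed
    ultimately show ?thesis by (intro exI[of _ F]) auto
  qed
  then show thesis using that[OF \<kappa>] by blast
qed

text \<open>Either \<open>f\<close> or its composition with the inversion \<open>J\<close> is inner
  bounded; in the second case the improvement is applied with base point \<open>J z\<close> at
  \<open>J w\<close> and composed with \<open>J\<close>. The smaller constant serves both
  cases.\<close>

lemma improve_injective:
  assumes r: "0 < r" "r < 1" and z: "z \<in> annulus r" and T: "0 < T" "T < 1"
  obtains \<kappa> where "\<kappa> > 1"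
    "\<forall>f w. f holomorphic_on annulus r \<and> f ` annulus r \<subseteq> unit_disk \<and> f z = 0 \<and>
       inj_on f (annulus r) \<and> w \<in> annulus r \<longrightarrow>
       (\<exists>F. F holomorphic_on annulus r \<and> F ` annulus r \<subseteq> unit_disk \<and>
          min (\<kappa> * norm (f w)) T \<le> norm (Moebius_function 0 (F z) (F w)))"
proof -
  obtain \<kappa>1 where \<kappa>1: "\<kappa>1 > 1"
    "\<forall>f w. f holomorphic_on annulus r \<and> f ` annulus r \<subseteq> unit_disk \<and> f z = 0 \<and>
       inner_bounded r f \<and> w \<in> annulus r \<longrightarrow>
       (\<exists>F. F holomorphic_on annulus r \<and> F ` annulus r \<subseteq> unit_disk \<and>
          min (\<kappa>1 * norm (f w)) T \<le> norm (Moebius_function 0 (F z) (F w)))"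
    by (rule improve_inner_bounded[OF r z T])
  define J where "J = (\<lambda>\<zeta>::complex. of_real r / \<zeta>)"
  have J: "J \<zeta> \<in> annulus r" if "\<zeta> \<in> annulus r" for \<zeta>
    unfolding J_def by (rule annulus_inversion[OF r(1) that])
  have JJ: "J (J \<zeta>) = \<zeta>" for \<zeta>
    unfolding J_def by (rule annulus_inversion_involution[OF r(1)])
  have holJ: "(\<lambda>\<zeta>. f (J \<zeta>)) holomorphic_on annulus r" if "f holomorphic_on annulus r" for f
    unfolding J_def by (rule holomorphic_on_compose_annulus_inversion[OF r(1) that])
  obtain \<kappa>2 where \<kappa>2: "\<kappa>2 > 1"
    "\<forall>f w. f holomorphic_on annulus r \<and> f ` annulus r \<subseteq> unit_disk \<and> f (J z) = 0 \<and>
       inner_bounded r f \<and> w \<in> annulus r \<longrightarrow>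
       (\<exists>F. F holomorphic_on annulus r \<and> F ` annulus r \<subseteq> unit_disk \<and>
          min (\<kappa>2 * norm (f w)) T \<le> norm (Moebius_function 0 (F (J z)) (F w)))"
    by (rule improve_inner_bounded[OF r J[OF z] T])
  define \<kappa> where "\<kappa> = min \<kappa>1 \<kappa>2"
  have mono: "min (\<kappa> * norm (f w)) T \<le> min (\<kappa>' * norm (f w)) T"
    if "\<kappa> \<le> \<kappa>'" for \<kappa>' and f :: "complex \<Rightarrow> complex" and w
    using that by (intro min.mono mult_right_mono) auto
  have *: "\<exists>F. F holomorphic_on annulus r \<and> F ` annulus r \<subseteq> unit_disk \<and>
          min (\<kappa> * norm (f w)) T \<le> norm (Moebius_function 0 (F z) (F w))"
    if f: "f holomorphic_on annulus r" "f ` annulus r \<subseteq> unit_disk" "f z = 0"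
      "inj_on f (annulus r)" and w: "w \<in> annulus r" for f w
    using inner_bounded_or_inversion[OF r f(1,4)]
  proof
    assume "inner_bounded r f"
    then obtain F where "F holomorphic_on annulus r" "F ` annulus r \<subseteq> unit_disk"
      "min (\<kappa>1 * norm (f w)) T \<le> norm (Moebius_function 0 (F z) (F w))"
      using \<kappa>1(2) f w by blast
    then show ?thesis using mono[of \<kappa>1 f w] by (intro exI[of _ F]) (simp add: \<kappa>_def)
  next
    assume inner: "inner_bounded r (\<lambda>\<zeta>. f (of_real r / \<zeta>))"
    have "(\<lambda>\<zeta>. f (J \<zeta>)) ` annulus r \<subseteq> unit_disk" using f(2) J by blast
    then obtain F where F: "F holomorphic_on annulus r" "F ` annulus r \<subseteq> unit_disk"
      "min (\<kappa>2 * norm (f (J (J w)))) T \<le> norm (Moebius_function 0 (F (J z)) (F (J w)))"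
      using \<kappa>2(2)[rule_format, of "\<lambda>\<zeta>. f (J \<zeta>)" "J w"] holJ[OF f(1)] f(3) J[OF w] inner
      unfolding J_def[symmetric] JJ by blast
    show ?thesis
    proof (intro exI[of _ "\<lambda>\<zeta>. F (J \<zeta>)"] conjI)
      show "(\<lambda>\<zeta>. F (J \<zeta>)) holomorphic_on annulus r" by (rule holJ[OF F(1)])
      show "(\<lambda>\<zeta>. F (J \<zeta>)) ` annulus r \<subseteq> unit_disk" using F(2) J by blast
      show "min (\<kappa> * norm (f w)) T \<le> norm (Moebius_function 0 (F (J z)) (F (J w)))"
        using F(3) mono[of \<kappa>2 f w] unfolding JJ by (simp add: \<kappa>_def)
    qed
  qed
  have "\<kappa> > 1" using \<kappa>1 \<kappa>2 by (simp add: \<kappa>_def)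
  then show thesis by (rule that) (intro allI impI, elim conjE, rule *)
qed

section \<open>Squeezing and Fridman functions\<close>

lemma bdd_above_tanh: "bdd_above {tanh (s / 2 :: real) | s. P s}"
  by (rule bdd_aboveI[of _ 1]) (auto intro: less_imp_le tanh_real_lt_1)

text \<open>Named so that maps close to the supremum can be chosen from it.\<close>

definition squeezing_radii :: "complex set \<Rightarrow> complex \<Rightarrow> real set" where
  "squeezing_radii X z = {tanh (s / 2) | s. s > 0 \<and>
     (\<exists>f. f holomorphic_on X \<and> inj_on f X \<and> f ` X \<subseteq> unit_disk \<and>
          dist_ball kobayashi_dist unit_disk (f z) s \<subseteq> f ` X)}"

lemma squeezing_eq_Sup: "squeezing X z = Sup (squeezing_radii X z)"
  by (simp add: squeezing_def squeezing_radii_def)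

text \<open>Following \<open>f\<close> by the Moebius map that sends \<open>f z\<close> to 0 turns
  the Kobayashi ball of radius \<open>s\<close> into the Euclidean disk of radius
  \<open>tanh (s / 2)\<close>.\<close>

lemma squeezing_normalized:
  assumes z: "z \<in> X" and s: "s > 0" and f: "f holomorphic_on X" "inj_on f X" "f ` X \<subseteq> unit_disk"
    and B: "dist_ball kobayashi_dist unit_disk (f z) s \<subseteq> f ` X"
  obtains g where "g holomorphic_on X" "inj_on g X" "g ` X \<subseteq> unit_disk" "g z = 0"
    "ball 0 (tanh (s / 2)) \<subseteq> g ` X"
proof -
  have fz: "norm (f z) < 1" using f(3) z by auto
  define \<phi> where "\<phi> = Moebius_function 0 (f z)"
  have \<phi>: "\<phi> holomorphic_on unit_disk" "\<phi> ` unit_disk \<subseteq> unit_disk" "\<phi> (f z) = 0"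
    unfolding \<phi>_def using fz
    by (auto simp: Moebius_function_eq_zero Moebius_function_norm_lt_1 intro!: Moebius_function_holomorphic)
  have inj: "inj_on \<phi> unit_disk"
  proof (rule inj_on_inverseI)
    show "Moebius_function 0 (- f z) (\<phi> x) = x" if "x \<in> unit_disk" for x
      unfolding \<phi>_def using Moebius_function_compose[of "- f z" "f z" x] fz that by simp
  qed
  show thesis
  proof
    show "\<phi> \<circ> f holomorphic_on X" by (rule holomorphic_on_compose_gen[OF f(1) \<phi>(1) f(3)])
    show "inj_on (\<phi> \<circ> f) X" by (rule comp_inj_on[OF f(2) inj_on_subset[OF inj f(3)]])
    show "(\<phi> \<circ> f) ` X \<subseteq> unit_disk" using f(3) \<phi>(2) by (auto simp: image_subset_iff)
    show "(\<phi> \<circ> f) z = 0" using \<phi> by simp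
    show "ball 0 (tanh (s / 2)) \<subseteq> (\<phi> \<circ> f) ` X"
    proof
      fix q :: complex assume "q \<in> ball 0 (tanh (s / 2))"
      then have q: "norm q < tanh (s / 2)" by simp
      then have q1: "norm q < 1" using tanh_real_lt_1[of "s / 2"] by linarith
      define p where "p = Moebius_function 0 (- f z) q"
      have p: "p \<in> unit_disk" unfolding p_def using Moebius_function_norm_lt_1[of "- f z" q] fz q1 by simp
      have \<phi>p: "\<phi> p = q"
        unfolding \<phi>_def p_def using Moebius_function_compose[of "f z" "- f z" q] fz q1 by simp
      have "kobayashi_dist unit_disk (f z) p = 2 * artanh (norm q)"
        using fz p \<phi>p by (simp add: kobayashi_dist_unit_disk poincare_dist_eq \<phi>_def)
      moreover have "artanh (norm q) < artanh (tanh (s / 2))"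
        using q q1 tanh_real_bounds[of "s / 2"] by (subst artanh_less_iff_real) auto
      ultimately have "p \<in> dist_ball kobayashi_dist unit_disk (f z) s"
        using p by (simp add: dist_ball_def artanh_tanh_real)
      then show "q \<in> (\<phi> \<circ> f) ` X" using B \<phi>p by force
    qed
  qed
qed

lemma squeezing_radii_normalized:
  assumes "z \<in> X" and "t \<in> squeezing_radii X z"
  obtains g where "g holomorphic_on X" "inj_on g X" "g ` X \<subseteq> unit_disk" "g z = 0"
    "ball 0 t \<subseteq> g ` X" "0 < t"
proof -
  obtain s f where s: "s > 0" "t = tanh (s / 2)"
    and f: "f holomorphic_on X" "inj_on f X" "f ` X \<subseteq> unit_disk"
      "dist_ball kobayashi_dist unit_disk (f z) s \<subseteq> f ` X"
    using assms(2) unfolding squeezing_radii_def by blast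
  show thesis
    by (rule squeezing_normalized[OF assms(1) s(1) f]) (use that s in simp)
qed

text \<open>\<open>s\<close> is the distance from \<open>f z\<close> to the circle of radius
  \<open>r\<close>: a point of the ball with modulus at most \<open>r\<close> would violate the
  triangle inequality through 0. The quotient is the addition formula for
  \<open>tanh\<close>.\<close>

lemma kobayashi_ball_subset_annulus:
  assumes r: "0 < r" "r < 1" and z: "z \<in> annulus r"
    and f: "f holomorphic_on annulus r" "inj_on f (annulus r)" "f ` annulus r = annulus r"
  shows "\<exists>s>0. tanh (s / 2) = (norm (f z) - r) / (1 - r * norm (f z)) \<and>
    dist_ball kobayashi_dist unit_disk (f z) s \<subseteq> f ` annulus r"
proof -
  have "f z \<in> annulus r" using f z by blast
  then have fz: "r < norm (f z)" "norm (f z) < 1" by (auto simp: annulus_def)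
  define s where "s = 2 * artanh (norm (f z)) - 2 * artanh r"
  have "artanh r < artanh (norm (f z))"
    using fz r by (subst artanh_less_iff_real) auto
  then have s: "s > 0" by (simp add: s_def)
  have "tanh (s / 2) = tanh (artanh (norm (f z)) + (- artanh r))" by (simp add: s_def)
  also have "\<dots> = (norm (f z) - r) / (1 - r * norm (f z))"
    using r fz by (subst tanh_add) (simp_all add: tanh_artanh_real mult.commute)
  finally have tanh: "tanh (s / 2) = \<dots>" .
  have "p \<in> annulus r" if "p \<in> dist_ball kobayashi_dist unit_disk (f z) s" for p
  proof (rule ccontr)
    assume no: "p \<notin> annulus r"
    have p: "p \<in> unit_disk" "kobayashi_dist unit_disk (f z) p < s"
      using that by (auto simp: dist_ball_def)
    then have pr: "norm p \<le> r" using no by (auto simp: annulus_def)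
    have "poincare_dist 0 (f z) \<le> poincare_dist 0 p + poincare_dist p (f z)"
      using p fz by (intro poincare_dist_triangle) auto
    then have "2 * artanh (norm (f z)) < 2 * artanh (norm p) + s"
      using p fz poincare_dist_commute[of p "f z"]
      by (simp add: poincare_dist_0 kobayashi_dist_unit_disk)
    moreover have "artanh (norm p) \<le> artanh r"
      using pr r by (subst artanh_le_iff_real) auto
    ultimately show False by (simp add: s_def)
  qed
  then show ?thesis using s tanh f(3) by auto
qed

lemma squeezing_radii_annulus:
  assumes r: "0 < r" "r < 1" and z: "z \<in> annulus r"
    and f: "f holomorphic_on annulus r" "inj_on f (annulus r)" "f ` annulus r = annulus r"
  shows "(norm (f z) - r) / (1 - r * norm (f z)) \<in> squeezing_radii (annulus r) z"
proof -
  obtain s where s: "s > 0" "tanh (s / 2) = (norm (f z) - r) / (1 - r * norm (f z))"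
    "dist_ball kobayashi_dist unit_disk (f z) s \<subseteq> f ` annulus r"
    using kobayashi_ball_subset_annulus[OF assms] by blast
  have "f ` annulus r \<subseteq> unit_disk" using f(3) annulus_subset_unit_disk by simp
  then have "tanh (s / 2) \<in> squeezing_radii (annulus r) z"
    unfolding squeezing_radii_def using s f by blast
  then show ?thesis using s(2) by simp
qed

lemma squeezing_ge: "t \<in> squeezing_radii X z \<Longrightarrow> t \<le> squeezing X z"
  unfolding squeezing_eq_Sup
  by (erule cSup_upper) (simp add: squeezing_radii_def bdd_above_tanh)

text \<open>The inclusion gives the first bound, the inversion the second; they tend to 1 at the
  outer and the inner circle respectively.\<close>

lemma squeezing_annulus_ge:
  assumes r: "0 < r" "r < 1" and z: "z \<in> annulus r"
  shows "(norm z - r) / (1 - r * norm z) \<le> squeezing (annulus r) z"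
    and "(r / norm z - r) / (1 - r * (r / norm z)) \<le> squeezing (annulus r) z"
proof -
  show "(norm z - r) / (1 - r * norm z) \<le> squeezing (annulus r) z"
    using squeezing_ge squeezing_radii_annulus[OF r z, of "\<lambda>\<zeta>. \<zeta>"] by simp
  have "(\<lambda>\<zeta>. of_real r / \<zeta>) ` annulus r = annulus r"
    using annulus_inversion[OF r(1)] annulus_inversion_involution[OF r(1)] by (force simp: image_iff)
  moreover have "inj_on (\<lambda>\<zeta>::complex. of_real r / \<zeta>) (annulus r)"
    by (rule inj_on_inverseI[of _ "\<lambda>\<zeta>. of_real r / \<zeta>"]) (rule annulus_inversion_involution[OF r(1)])
  ultimately show "(r / norm z - r) / (1 - r * (r / norm z)) \<le> squeezing (annulus r) z"
    using squeezing_ge squeezing_radii_annulus[OF r z holomorphic_on_annulus_inversion[OF r(1)]] r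
    by (simp add: norm_divide)
qed

section \<open>Comparison of the Fridman and squeezing functions\<close>

text \<open>The competing disk \<open>h\<close> is the inverse of \<open>f\<close> on
  \<open>ball 0 t\<close>, rescaled to the unit disk. A point \<open>w\<close> outside its image has
  \<open>|f w| \<ge> t\<close>, so \<open>far\<close> puts it at distance at least
  \<open>2 * artanh u\<close> from \<open>z\<close>. The same \<open>h\<close> shows that the
  supremum is over a nonempty set, which gives the upper bound 1.\<close>

lemma fridman_annulus_ge:
  assumes r: "0 < r" "r < 1" and d: "d = kobayashi_dist \<or> d = caratheodory_dist"
    and z: "z \<in> annulus r"
    and f: "f holomorphic_on annulus r" "inj_on f (annulus r)"
    and t: "0 < t" "ball 0 t \<subseteq> f ` annulus r" and u: "0 < u" "u < 1"
    and far: "\<And>w. w \<in> annulus r \<Longrightarrow> t \<le> norm (f w) \<Longrightarrow>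
       \<exists>F. F holomorphic_on annulus r \<and> F ` annulus r \<subseteq> unit_disk \<and>
          u \<le> norm (Moebius_function 0 (F z) (F w))"
  shows "u \<le> fridman d (annulus r) z" and "fridman d (annulus r) z \<le> 1"
proof -
  define H where "H = {tanh (s / 2) | s. s > 0 \<and>
      (\<exists>f. f holomorphic_on unit_disk \<and> inj_on f unit_disk \<and> f ` unit_disk \<subseteq> annulus r \<and>
          dist_ball d (annulus r) z s \<subseteq> f ` unit_disk)}"
  obtain g where g: "g holomorphic_on f ` annulus r" "\<And>z. z \<in> annulus r \<Longrightarrow> g (f z) = z"
    using holomorphic_has_inverse[OF f(1) open_annulus f(2)] by metis
  have fg: "g q \<in> annulus r \<and> f (g q) = q" if "q \<in> ball 0 t" for q
    using that t(2) g(2) by force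
  define h where "h = (\<lambda>\<zeta>. g (of_real t * \<zeta>))"
  have tD: "of_real t * \<zeta> \<in> ball 0 t" if "\<zeta> \<in> unit_disk" for \<zeta>
    using that t(1) by (simp add: norm_mult)
  have "h holomorphic_on unit_disk"
    unfolding h_def
    by (rule holomorphic_on_compose_gen[of "\<lambda>\<zeta>. of_real t * \<zeta>" _ g "f ` annulus r", unfolded o_def])
      (use tD t(2) in \<open>auto intro!: holomorphic_intros g(1)\<close>)
  moreover have "inj_on h unit_disk"
  proof (rule inj_on_inverseI)
    show "f (h \<zeta>) / of_real t = \<zeta>" if "\<zeta> \<in> unit_disk" for \<zeta>
      using fg[OF tD[OF that]] t(1) by (simp add: h_def)
  qed
  moreover have "h ` unit_disk \<subseteq> annulus r" using fg tD by (auto simp: h_def)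
  moreover have "dist_ball d (annulus r) z (2 * artanh u) \<subseteq> h ` unit_disk"
  proof
    fix w assume "w \<in> dist_ball d (annulus r) z (2 * artanh u)"
    then have w: "w \<in> annulus r" "d (annulus r) z w < 2 * artanh u" by (auto simp: dist_ball_def)
    have "norm (f w) < t"
    proof (rule ccontr)
      assume "\<not> norm (f w) < t"
      then obtain F where F: "F holomorphic_on annulus r" "F ` annulus r \<subseteq> unit_disk"
          "u \<le> norm (Moebius_function 0 (F z) (F w))"
        using far[OF w(1)] by auto
      have FD: "F z \<in> unit_disk" "F w \<in> unit_disk" using F(2) z w(1) by blast+
      then have "norm (Moebius_function 0 (F z) (F w)) < 1" by (simp add: Moebius_function_norm_lt_1)
      then have "artanh u \<le> artanh (norm (Moebius_function 0 (F z) (F w)))"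
        using F(3) u by (subst artanh_le_iff_real) auto
      then have "2 * artanh u \<le> poincare_dist (F z) (F w)" using FD by (simp add: poincare_dist_eq)
      also have "\<dots> \<le> d (annulus r) z w"
        by (rule poincare_dist_le_annulus_dist[OF r d F(1,2) z w(1)])
      finally show False using w(2) by simp
    qed
    then have "f w / of_real t \<in> unit_disk" "h (f w / of_real t) = w"
      using t(1) g(2)[OF w(1)] by (auto simp: h_def norm_divide)
    then show "w \<in> h ` unit_disk" by (metis imageI)
  qed
  moreover have "artanh 0 < artanh u" using u by (subst artanh_less_iff_real) auto
  then have "0 < 2 * artanh u" by simp
  ultimately have mem: "tanh (2 * artanh u / 2) \<in> H"
    unfolding H_def by blast
  have "fridman d (annulus r) z = Sup H" by (simp add: fridman_def H_def)
  moreover have le1: "x \<le> 1" if "x \<in> H" for x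
    using that by (auto simp: H_def less_imp_le tanh_real_lt_1)
  moreover have "tanh (2 * artanh u / 2) \<le> Sup H"
    using mem by (rule cSup_upper) (rule bdd_aboveI[OF le1])
  moreover have "Sup H \<le> 1"
    using mem by (intro cSup_least le1) auto
  ultimately show "u \<le> fridman d (annulus r) z" "fridman d (annulus r) z \<le> 1"
    using u by (simp_all add: tanh_artanh_real)
qed

lemma squeezing_annulus_pos:
  assumes r: "0 < r" "r < 1" and z: "z \<in> annulus r"
  shows "0 < squeezing (annulus r) z"
proof -
  have zn: "r < norm z" "norm z < 1" using z by (auto simp: annulus_def)
  then have "r * norm z < 1" using r mult_strict_mono[of r 1 "norm z" 1] by simp
  then have "0 < (norm z - r) / (1 - r * norm z)" using zn by simp
  then show ?thesis using squeezing_annulus_ge(1)[OF r z] by simp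
qed

lemma squeezing_radii_annulus_nonempty:
  assumes r: "0 < r" "r < 1" and z: "z \<in> annulus r"
  shows "squeezing_radii (annulus r) z \<noteq> {}"
  using squeezing_radii_annulus[OF r z, of "\<lambda>\<zeta>. \<zeta>"] by auto

text \<open>The bound \<open>M\<close> on a circle is uniform over normalized maps and limits the
  disk each of them covers, so it survives the supremum.\<close>

lemma squeezing_annulus_less_1:
  assumes r: "0 < r" "r < 1" and z: "z \<in> annulus r"
  shows "squeezing (annulus r) z < 1"
proof -
  define \<rho> where "\<rho> = (r + 1) / 2"
  have \<rho>: "r < \<rho>" "\<rho> < 1" using r by (simp_all add: \<rho>_def)
  obtain M where M: "0 < M" "M < 1"
    "\<And>F \<zeta>. F holomorphic_on annulus r \<Longrightarrow> F ` annulus r \<subseteq> unit_disk \<Longrightarrow> F z = 0 \<Longrightarrow>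
       norm \<zeta> = \<rho> \<Longrightarrow> norm (F \<zeta>) \<le> M"
    using annulus_circle_bound[OF r z \<rho>] by metis
  have "t \<le> M" if t: "t \<in> squeezing_radii (annulus r) z" for t
  proof -
    obtain g where g: "g holomorphic_on annulus r" "inj_on g (annulus r)"
      "g ` annulus r \<subseteq> unit_disk" "g z = 0" "ball 0 t \<subseteq> g ` annulus r"
      by (rule squeezing_radii_normalized[OF z t])
    show ?thesis
      by (rule covered_disk_radius_le[OF r(1) \<rho> g(1,2,5)]) (rule M(3)[OF g(1,3,4)])
  qed
  then have "squeezing (annulus r) z \<le> M"
    unfolding squeezing_eq_Sup by (rule cSup_least[OF squeezing_radii_annulus_nonempty[OF r z]])
  then show ?thesis using M(2) by simp
qed

text \<open>The gain factor \<kappa> is fixed before the map is chosen, so a map within the factor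
  \<kappa> of the supremum already suffices.\<close>

lemma squeezing_less_fridman_annulus:
  assumes r: "0 < r" "r < 1" and d: "d = kobayashi_dist \<or> d = caratheodory_dist"
    and z: "z \<in> annulus r"
  shows "squeezing (annulus r) z < fridman d (annulus r) z \<and> fridman d (annulus r) z \<le> 1"
proof -
  define S where "S = squeezing (annulus r) z"
  have S: "0 < S" "S < 1"
    unfolding S_def using squeezing_annulus_pos[OF r z] squeezing_annulus_less_1[OF r z] .
  \<comment> \<open>Strictly between \<open>S\<close> and 1, so that the cap \<open>T\<close> in the
    improvement still exceeds \<open>S\<close>.\<close>
  define T where "T = (S + 1) / 2"
  have T: "0 < T" "T < 1" "S < T" using S by (simp_all add: T_def)
  obtain \<kappa> where \<kappa>: "\<kappa> > 1"
    "\<forall>f w. f holomorphic_on annulus r \<and> f ` annulus r \<subseteq> unit_disk \<and> f z = 0 \<and>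
       inj_on f (annulus r) \<and> w \<in> annulus r \<longrightarrow>
       (\<exists>F. F holomorphic_on annulus r \<and> F ` annulus r \<subseteq> unit_disk \<and>
          min (\<kappa> * norm (f w)) T \<le> norm (Moebius_function 0 (F z) (F w)))"
    by (rule improve_injective[OF r z T(1,2)])
  have "S / \<kappa> < S" using S \<kappa>(1) by (simp add: field_simps)
  then obtain t where t: "t \<in> squeezing_radii (annulus r) z" "S / \<kappa> < t"
    unfolding S_def squeezing_eq_Sup
    using less_cSupE[OF _ squeezing_radii_annulus_nonempty[OF r z]] by blast
  then have \<kappa>t: "S < \<kappa> * t" using \<kappa>(1) by (simp add: field_simps)
  obtain g where g: "g holomorphic_on annulus r" "inj_on g (annulus r)"
      "g ` annulus r \<subseteq> unit_disk" "g z = 0" "ball 0 t \<subseteq> g ` annulus r" and t0: "0 < t"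
    by (rule squeezing_radii_normalized[OF z t(1)])
  define u where "u = min (\<kappa> * t) T"
  have u: "0 < u" "u < 1" "S < u"
    using t0 \<kappa>(1) T \<kappa>t by (simp_all add: u_def min_less_iff_disj)
  have far: "\<exists>F. F holomorphic_on annulus r \<and> F ` annulus r \<subseteq> unit_disk \<and>
      u \<le> norm (Moebius_function 0 (F z) (F w))"
    if w: "w \<in> annulus r" "t \<le> norm (g w)" for w
  proof -
    obtain F where "F holomorphic_on annulus r" "F ` annulus r \<subseteq> unit_disk"
      "min (\<kappa> * norm (g w)) T \<le> norm (Moebius_function 0 (F z) (F w))"
      using \<kappa>(2) g w(1) by blast
    moreover have "u \<le> min (\<kappa> * norm (g w)) T"
      unfolding u_def using w(2) \<kappa>(1) by (intro min.mono mult_left_mono) auto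
    ultimately show ?thesis by (intro exI[of _ F]) linarith
  qed
  have "u \<le> fridman d (annulus r) z" "fridman d (annulus r) z \<le> 1"
    using fridman_annulus_ge[OF r d z g(1,2) t0 g(5) u(1,2) far] by blast+
  then show ?thesis using u(3) by (simp add: S_def)
qed

section \<open>The quotient and its boundary limits\<close>

lemma norm_frontier_annulus:
  assumes "p \<in> frontier (annulus r)"
  shows "norm p = r \<or> norm p = 1"
proof -
  have "closed (cball 0 1 - ball 0 r :: complex set)" by (intro closed_Diff) auto
  moreover have "annulus r \<subseteq> cball 0 1 - ball 0 r" by (auto simp: annulus_def)
  ultimately have "closure (annulus r) \<subseteq> cball 0 1 - ball 0 r" by (intro closure_minimal)
  moreover have "p \<in> closure (annulus r)" "p \<notin> annulus r"
    using assms interior_open[OF open_annulus[of r]] by (auto simp: frontier_def)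
  ultimately have "r \<le> norm p" "norm p \<le> 1" "\<not> (r < norm p \<and> norm p < 1)"
    by (auto simp: annulus_def)
  then show ?thesis by linarith
qed

text \<open>Dividing the positive squeezing function by a number at most 1 does not decrease
  it.\<close>

lemma quotient_invariant_annulus:
  assumes r: "0 < r" "r < 1" and d: "d = kobayashi_dist \<or> d = caratheodory_dist"
    and z: "z \<in> annulus r"
  shows "quotient_invariant d (annulus r) z < 1"
    and "squeezing (annulus r) z \<le> quotient_invariant d (annulus r) z"
proof -
  have "0 < squeezing (annulus r) z" "squeezing (annulus r) z < fridman d (annulus r) z"
    "fridman d (annulus r) z \<le> 1"
    using squeezing_annulus_pos[OF r z] squeezing_less_fridman_annulus[OF r d z] by simp_all
  then show "quotient_invariant d (annulus r) z < 1"
    and "squeezing (annulus r) z \<le> quotient_invariant d (annulus r) z"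
    by (simp_all add: quotient_invariant_def pos_le_divide_eq mult_left_le)
qed

lemma quotient_invariant_annulus_tendsto:
  assumes r: "0 < r" "r < 1" and d: "d = kobayashi_dist \<or> d = caratheodory_dist"
    and p: "p \<in> frontier (annulus r)"
  shows "(quotient_invariant d (annulus r) \<longlongrightarrow> 1) (at p within annulus r)"
proof -
  \<comment> \<open>\<open>b\<close> is whichever explicit lower bound tends to 1 at
    \<open>p\<close>: that of the inclusion if \<open>|p| = 1\<close>, that of the inversion if
    \<open>|p| = r\<close>. The quotient is then squeezed between \<open>b\<close> and 1.\<close>
  obtain b where b: "(b \<longlongrightarrow> 1) (at p within annulus r)"
    "\<And>z. z \<in> annulus r \<Longrightarrow> b z \<le> squeezing (annulus r) z"
  proof (cases "norm p = 1")
    case True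
    have "((\<lambda>z. (norm z - r) / (1 - r * norm z)) \<longlongrightarrow> (norm p - r) / (1 - r * norm p))
        (at p within annulus r)"
      using True r by (intro tendsto_intros) auto
    moreover have "(norm p - r) / (1 - r * norm p) = 1" using True r by simp
    ultimately show thesis
      by (intro that[OF _ squeezing_annulus_ge(1)[OF r]]) (simp only:)
  next
    case False
    then have pr: "norm p = r" using norm_frontier_annulus[OF p] by simp
    have "((\<lambda>z. (r / norm z - r) / (1 - r * (r / norm z))) \<longlongrightarrow>
        (r / norm p - r) / (1 - r * (r / norm p))) (at p within annulus r)"
      using pr r by (intro tendsto_intros) auto
    moreover have "(r / norm p - r) / (1 - r * (r / norm p)) = 1" using pr r by simp
    ultimately show thesis
      by (intro that[OF _ squeezing_annulus_ge(2)[OF r]]) (simp only:)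
  qed
  have ev: "eventually (\<lambda>z. z \<in> annulus r) (at p within annulus r)"
    by (simp add: eventually_at_filter)
  show "(quotient_invariant d (annulus r) \<longlongrightarrow> 1) (at p within annulus r)"
  proof (rule tendsto_sandwich[OF _ _ b(1) tendsto_const])
    show "\<forall>\<^sub>F z in at p within annulus r. b z \<le> quotient_invariant d (annulus r) z"
      using ev by eventually_elim (rule order_trans[OF b(2) quotient_invariant_annulus(2)[OF r d]])
    show "\<forall>\<^sub>F z in at p within annulus r. quotient_invariant d (annulus r) z \<le> 1"
      using ev by eventually_elim (rule less_imp_le[OF quotient_invariant_annulus(1)[OF r d]])
  qed
qed

theorem theorem3p15:
  fixes r :: real
    and d :: "complex set \<Rightarrow> complex \<Rightarrow> complex \<Rightarrow> real"
  assumes "0 < r" and "r < 1"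
    and "d = kobayashi_dist \<or> d = caratheodory_dist"
  shows "(\<forall>z\<in>annulus r. quotient_invariant d (annulus r) z < 1) \<and>
         (\<forall>p\<in>frontier (annulus r).
            (quotient_invariant d (annulus r) \<longlongrightarrow> 1) (at p within annulus r))"
  using assms quotient_invariant_annulus(1) quotient_invariant_annulus_tendsto
  by (metis not_less order_trans)

end
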